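(* Let $(X,S)$ be a nondegenerate symmetric set. The categories $BL(X,S)$ (blow-ups of $(X,S)$) and $Bun_f(X,G_X)$ (faithful $G_X$-equivariant fiber bundles over $X$) are equivalent. In particular, there is a one-to-one correspondence between isomorphism classes of blow-ups of size $n$ and isomorphism classes of faithful bundles of size $n$.
   Context: Let $X$ be a nonempty set and $S:X\times X\to X\times X$ a bijection, $S(x,y)=(g_x(y),f_y(x))$. $(X,S)$ is nondegenerate if all maps $f_y,g_x:X\to X$ are bijections; braided if $S^{12}S^{23}S^{12}=S^{23}S^{12}S^{23}$ on $X^3$; involutive if $S^2=\mathrm{id}$; symmetric if braided and involutive. A homomorphism $(X_1,S_1)\to (X_2,S_2)$ is a map $h:X_1\to X_2$ with $(h\times h)S_1=S_2(h\times h)$. The structure group $G_X$ is generated by the elements of $X$ with defining relations $xy=tz$ whenever $S(x,y)=(t,z)$; the map $X\to G_X$ is injective. $G_X$ acts on $X$ on the left by $x\mapsto f_x^{-1}$. Retraction. For a nondegenerate symmetric set $(Y,S_Y)$ write $x\sim y$ if $f_x=f_y$ (then also $g_x=g_y$). Let $\bar Y=Y/\!\sim$, with classes $\bar x$. Then $\bar S(\bar x,\bar y)=(\overline{g_x(y)},\overline{f_y(x)})$ is well defined and makes $\bar Y$ a nondegenerate symmetric set, called the retraction $\mathrm{Ret}(Y,S_Y)=(\bar Y,\bar S)$. Blow-ups. $BL(X,S)$ is the category of nondegenerate symmetric sets $(Y,S_Y)$ with $\mathrm{Ret}(Y,S_Y)=(X,S)$ (i.e. with an identification of the retraction with $(X,S)$);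 its morphisms are homomorphisms of nondegenerate symmetric sets which become the identity of $(X,S)$ under retraction. Bundles. For a group $G$ acting on $X$, a $G$-equivariant fiber bundle over $X$ is a set $Y$ with a surjective map $p:Y\to X$ and an action $\rho$ of $G$ on $Y$ which respects $p$ and descends under $p$ to the given action of $G$ on $X$. $Bun(X,G)$ is the category of such bundles, with morphisms the $G$-equivariant bundle maps (commuting with the projections to $X$). $Bun_f(X,G_X)$ is the full subcategory of $Bun(X,G_X)$ of faithful bundles, i.e. those with $\rho(x)\neq\rho(y)$ for all $x,y\in X\subset G_X$, $x\ne y$. *)

theory Defs
  imports "HOL-Algebra.Group_Action" "HOL-Library.Equipollence"
begin

section \<open>Set-theoretical solutions\<close>

text \<open>A map $S(x,y) = (g_x(y), f_y(x))$ on a set $X$ is a function on pairs.  Note the order of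
  the arguments: \<open>gmap S x y\<close> is $g_x(y)$ and \<open>fmap S y x\<close> is $f_y(x)$.\<close>

definition gmap :: "('a \<times> 'a \<Rightarrow> 'a \<times> 'a) \<Rightarrow> 'a \<Rightarrow> 'a \<Rightarrow> 'a" where
  "gmap S x y = fst (S (x, y))"

definition fmap :: "('a \<times> 'a \<Rightarrow> 'a \<times> 'a) \<Rightarrow> 'a \<Rightarrow> 'a \<Rightarrow> 'a" where
  "fmap S y x = snd (S (x, y))"

definition nondegenerate :: "'a set \<Rightarrow> ('a \<times> 'a \<Rightarrow> 'a \<times> 'a) \<Rightarrow> bool" where
  "nondegenerate X S \<longleftrightarrow>
     (\<forall>x\<in>X. bij_betw (gmap S x) X X) \<and> (\<forall>y\<in>X. bij_betw (fmap S y) X X)"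

definition S12 :: "('a \<times> 'a \<Rightarrow> 'a \<times> 'a) \<Rightarrow> 'a \<times> 'a \<times> 'a \<Rightarrow> 'a \<times> 'a \<times> 'a" where
  "S12 S = (\<lambda>(x, y, z). case S (x, y) of (t, u) \<Rightarrow> (t, u, z))"

definition S23 :: "('a \<times> 'a \<Rightarrow> 'a \<times> 'a) \<Rightarrow> 'a \<times> 'a \<times> 'a \<Rightarrow> 'a \<times> 'a \<times> 'a" where
  "S23 S = (\<lambda>(x, y, z). (x, S (y, z)))"

definition braided :: "'a set \<Rightarrow> ('a \<times> 'a \<Rightarrow> 'a \<times> 'a) \<Rightarrow> bool" where
  "braided X S \<longleftrightarrow>
     (\<forall>w \<in> X \<times> X \<times> X. S12 S (S23 S (S12 S w)) = S23 S (S12 S (S23 S w)))"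

definition involutive :: "'a set \<Rightarrow> ('a \<times> 'a \<Rightarrow> 'a \<times> 'a) \<Rightarrow> bool" where
  "involutive X S \<longleftrightarrow> (\<forall>w \<in> X \<times> X. S (S w) = w)"

definition nondeg_symmetric_set :: "'a set \<Rightarrow> ('a \<times> 'a \<Rightarrow> 'a \<times> 'a) \<Rightarrow> bool" where
  "nondeg_symmetric_set X S \<longleftrightarrow>
     X \<noteq> {} \<and> bij_betw S (X \<times> X) (X \<times> X) \<and> nondegenerate X S \<and> braided X S \<and> involutive X S"

definition homomorphism ::
  "'a set \<Rightarrow> ('a \<times> 'a \<Rightarrow> 'a \<times> 'a) \<Rightarrow> 'b set \<Rightarrow> ('b \<times> 'b \<Rightarrow> 'b \<times> 'b) \<Rightarrow> ('a \<Rightarrow> 'b) \<Rightarrow> bool" where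
  "homomorphism X1 S1 X2 S2 h \<longleftrightarrow>
     h \<in> X1 \<rightarrow> X2 \<and> (\<forall>w \<in> X1 \<times> X1. map_prod h h (S1 w) = S2 (map_prod h h w))"

section \<open>Retraction\<close>

definition ret_rel :: "'a set \<Rightarrow> ('a \<times> 'a \<Rightarrow> 'a \<times> 'a) \<Rightarrow> ('a \<times> 'a) set" where
  "ret_rel Y S = {(x, y). x \<in> Y \<and> y \<in> Y \<and> (\<forall>z\<in>Y. fmap S x z = fmap S y z)}"

abbreviation ret_class :: "'a set \<Rightarrow> ('a \<times> 'a \<Rightarrow> 'a \<times> 'a) \<Rightarrow> 'a \<Rightarrow> 'a set" where
  "ret_class Y S x \<equiv> ret_rel Y S `` {x}"

definition ret_set :: "'a set \<Rightarrow> ('a \<times> 'a \<Rightarrow> 'a \<times> 'a) \<Rightarrow> 'a set set" where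
  "ret_set Y S = Y // ret_rel Y S"

text \<open>The unions below are the usual way to define an operation on classes through
  representatives: all the sets in the union are one and the same class.\<close>

definition ret_map :: "'a set \<Rightarrow> ('a \<times> 'a \<Rightarrow> 'a \<times> 'a) \<Rightarrow> 'a set \<times> 'a set \<Rightarrow> 'a set \<times> 'a set" where
  "ret_map Y S = (\<lambda>(A, B).
     (\<Union>x\<in>A. \<Union>y\<in>B. ret_class Y S (gmap S x y), \<Union>x\<in>A. \<Union>y\<in>B. ret_class Y S (fmap S y x)))"

section \<open>The structure group\<close>

text \<open>Words in the generators and their inverses: \<open>(x, True)\<close> stands for $x$ and \<open>(x, False)\<close>
  for $x^{-1}$.\<close>

definition group_words :: "'a set \<Rightarrow> ('a \<times> bool) list set" where
  "group_words X = lists (X \<times> UNIV)"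

inductive word_eq :: "'a set \<Rightarrow> ('a \<times> 'a \<Rightarrow> 'a \<times> 'a) \<Rightarrow> ('a \<times> bool) list \<Rightarrow> ('a \<times> bool) list \<Rightarrow> bool"
  for X S where
  refl: "u \<in> group_words X \<Longrightarrow> word_eq X S u u"
| sym: "word_eq X S u v \<Longrightarrow> word_eq X S v u"
| trans: "word_eq X S u v \<Longrightarrow> word_eq X S v w \<Longrightarrow> word_eq X S u w"
| cancel: "u \<in> group_words X \<Longrightarrow> v \<in> group_words X \<Longrightarrow> x \<in> X \<Longrightarrow>
    word_eq X S (u @ [(x, b), (x, \<not> b)] @ v) (u @ v)"
| relation: "u \<in> group_words X \<Longrightarrow> v \<in> group_words X \<Longrightarrow> x \<in> X \<Longrightarrow> y \<in> X \<Longrightarrow> S (x, y) = (t, z) \<Longrightarrow>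
    word_eq X S (u @ [(x, True), (y, True)] @ v) (u @ [(t, True), (z, True)] @ v)"

definition word_class :: "'a set \<Rightarrow> ('a \<times> 'a \<Rightarrow> 'a \<times> 'a) \<Rightarrow> ('a \<times> bool) list \<Rightarrow> ('a \<times> bool) list set"
  where "word_class X S u = {v. word_eq X S u v}"

definition structure_group :: "'a set \<Rightarrow> ('a \<times> 'a \<Rightarrow> 'a \<times> 'a) \<Rightarrow> ('a \<times> bool) list set monoid" where
  "structure_group X S =
     \<lparr>carrier = word_class X S ` group_words X,
      mult = (\<lambda>A B. \<Union>u\<in>A. \<Union>v\<in>B. word_class X S (u @ v)),
      one = word_class X S []\<rparr>"

definition generator :: "'a set \<Rightarrow> ('a \<times> 'a \<Rightarrow> 'a \<times> 'a) \<Rightarrow> 'a \<Rightarrow> ('a \<times> bool) list set" where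
  "generator X S x = word_class X S [(x, True)]"

text \<open>The left action of the structure group on \<open>X\<close> with $x \mapsto f_x^{-1}$.  It is defined on
  words letter by letter; the result does not depend on the word chosen in a class.\<close>

definition letter_act :: "'a set \<Rightarrow> ('a \<times> 'a \<Rightarrow> 'a \<times> 'a) \<Rightarrow> 'a \<times> bool \<Rightarrow> 'a \<Rightarrow> 'a" where
  "letter_act X S = (\<lambda>(x, b). if b then (\<lambda>z\<in>X. inv_into X (fmap S x) z) else (\<lambda>z\<in>X. fmap S x z))"

definition word_act :: "'a set \<Rightarrow> ('a \<times> 'a \<Rightarrow> 'a \<times> 'a) \<Rightarrow> ('a \<times> bool) list \<Rightarrow> 'a \<Rightarrow> 'a" where
  "word_act X S w = foldr (\<lambda>l \<phi>. compose X (letter_act X S l) \<phi>) w (\<lambda>z\<in>X. z)"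

definition structure_action :: "'a set \<Rightarrow> ('a \<times> 'a \<Rightarrow> 'a \<times> 'a) \<Rightarrow> ('a \<times> bool) list set \<Rightarrow> 'a \<Rightarrow> 'a" where
  "structure_action X S = (\<lambda>A \<in> carrier (structure_group X S). word_act X S (SOME w. w \<in> A))"

section \<open>Categories and equivalences\<close>

text \<open>Morphisms between \<open>A\<close> and \<open>B\<close> form a set \<open>Mor C A B\<close>; these sets need not be disjoint, so
  composition (and the action of a functor on morphisms) takes the objects as arguments:
  \<open>Cmp C A B D g f\<close> is $g \circ f$ for $f : A \to B$ and $g : B \to D$.\<close>

record ('o, 'm) cat =
  Obj :: "'o set"
  Mor :: "'o \<Rightarrow> 'o \<Rightarrow> 'm set"
  Idt :: "'o \<Rightarrow> 'm"
  Cmp :: "'o \<Rightarrow> 'o \<Rightarrow> 'o \<Rightarrow> 'm \<Rightarrow> 'm \<Rightarrow> 'm"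

definition is_category :: "('o, 'm) cat \<Rightarrow> bool" where
  "is_category C \<longleftrightarrow>
     (\<forall>A\<in>Obj C. Idt C A \<in> Mor C A A) \<and>
     (\<forall>A\<in>Obj C. \<forall>B\<in>Obj C. \<forall>D\<in>Obj C. \<forall>f\<in>Mor C A B. \<forall>g\<in>Mor C B D. Cmp C A B D g f \<in> Mor C A D) \<and>
     (\<forall>A\<in>Obj C. \<forall>B\<in>Obj C. \<forall>f\<in>Mor C A B.
        Cmp C A A B f (Idt C A) = f \<and> Cmp C A B B (Idt C B) f = f) \<and>
     (\<forall>A\<in>Obj C. \<forall>B\<in>Obj C. \<forall>D\<in>Obj C. \<forall>E\<in>Obj C.
        \<forall>f\<in>Mor C A B. \<forall>g\<in>Mor C B D. \<forall>h\<in>Mor C D E.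
          Cmp C A D E h (Cmp C A B D g f) = Cmp C A B E (Cmp C B D E h g) f)"

definition is_iso :: "('o, 'm) cat \<Rightarrow> 'o \<Rightarrow> 'o \<Rightarrow> 'm \<Rightarrow> bool" where
  "is_iso C A B f \<longleftrightarrow> f \<in> Mor C A B \<and>
     (\<exists>g\<in>Mor C B A. Cmp C A B A g f = Idt C A \<and> Cmp C B A B f g = Idt C B)"

definition iso_rel :: "('o, 'm) cat \<Rightarrow> ('o \<times> 'o) set" where
  "iso_rel C = {(A, B). A \<in> Obj C \<and> B \<in> Obj C \<and> (\<exists>f. is_iso C A B f)}"

definition full_subcategory :: "('o, 'm) cat \<Rightarrow> ('o \<Rightarrow> bool) \<Rightarrow> ('o, 'm) cat" where
  "full_subcategory C P = C\<lparr>Obj := {A \<in> Obj C. P A}\<rparr>"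

record ('o, 'm, 'p, 'q) cat_functor =
  on_obj :: "'o \<Rightarrow> 'p"
  on_mor :: "'o \<Rightarrow> 'o \<Rightarrow> 'm \<Rightarrow> 'q"

definition is_functor :: "('o, 'm) cat \<Rightarrow> ('p, 'q) cat \<Rightarrow> ('o, 'm, 'p, 'q) cat_functor \<Rightarrow> bool" where
  "is_functor C D F \<longleftrightarrow> is_category C \<and> is_category D \<and>
     (\<forall>A\<in>Obj C. on_obj F A \<in> Obj D) \<and>
     (\<forall>A\<in>Obj C. \<forall>B\<in>Obj C. \<forall>f\<in>Mor C A B. on_mor F A B f \<in> Mor D (on_obj F A) (on_obj F B)) \<and>
     (\<forall>A\<in>Obj C. on_mor F A A (Idt C A) = Idt D (on_obj F A)) \<and>
     (\<forall>A\<in>Obj C. \<forall>B\<in>Obj C. \<forall>E\<in>Obj C. \<forall>f\<in>Mor C A B. \<forall>g\<in>Mor C B E.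
        on_mor F A E (Cmp C A B E g f) =
        Cmp D (on_obj F A) (on_obj F B) (on_obj F E) (on_mor F B E g) (on_mor F A B f))"

definition identity_functor :: "('o, 'm, 'o, 'm) cat_functor" where
  "identity_functor = \<lparr>on_obj = (\<lambda>A. A), on_mor = (\<lambda>A B f. f)\<rparr>"

definition composite_functor ::
  "('p, 'q, 'r, 's) cat_functor \<Rightarrow> ('o, 'm, 'p, 'q) cat_functor \<Rightarrow> ('o, 'm, 'r, 's) cat_functor" where
  "composite_functor G F =
     \<lparr>on_obj = (\<lambda>A. on_obj G (on_obj F A)),
      on_mor = (\<lambda>A B f. on_mor G (on_obj F A) (on_obj F B) (on_mor F A B f))\<rparr>"

definition is_natural_iso ::
  "('o, 'm) cat \<Rightarrow> ('p, 'q) cat \<Rightarrow> ('o, 'm, 'p, 'q) cat_functor \<Rightarrow> ('o, 'm, 'p, 'q) cat_functor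
    \<Rightarrow> ('o \<Rightarrow> 'q) \<Rightarrow> bool" where
  "is_natural_iso C D F G \<eta> \<longleftrightarrow> is_functor C D F \<and> is_functor C D G \<and>
     (\<forall>A\<in>Obj C. is_iso D (on_obj F A) (on_obj G A) (\<eta> A)) \<and>
     (\<forall>A\<in>Obj C. \<forall>B\<in>Obj C. \<forall>f\<in>Mor C A B.
        Cmp D (on_obj F A) (on_obj F B) (on_obj G B) (\<eta> B) (on_mor F A B f) =
        Cmp D (on_obj F A) (on_obj G A) (on_obj G B) (on_mor G A B f) (\<eta> A))"

definition is_equivalence :: "('o, 'm) cat \<Rightarrow> ('p, 'q) cat \<Rightarrow> ('o, 'm, 'p, 'q) cat_functor \<Rightarrow> bool" where
  "is_equivalence C D F \<longleftrightarrow> is_functor C D F \<and>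
     (\<exists>G \<eta> \<epsilon>. is_functor D C G \<and>
        is_natural_iso C C identity_functor (composite_functor G F) \<eta> \<and>
        is_natural_iso D D (composite_functor F G) identity_functor \<epsilon>)"

section \<open>Blow-ups\<close>

text \<open>A blow-up of \<open>(X, S)\<close> is a nondegenerate symmetric set together with an isomorphism
  \<open>bl_ident\<close> of its retraction with \<open>(X, S)\<close>.  Functions that are part of an object, and
  morphisms, are extensional, so that they are determined by their values on their domains.\<close>

record ('y, 'x) blowup =
  bl_set :: "'y set"
  bl_map :: "'y \<times> 'y \<Rightarrow> 'y \<times> 'y"
  bl_ident :: "'y set \<Rightarrow> 'x"

definition is_blowup :: "'x set \<Rightarrow> ('x \<times> 'x \<Rightarrow> 'x \<times> 'x) \<Rightarrow> ('y, 'x) blowup \<Rightarrow> bool" where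
  "is_blowup X S B \<longleftrightarrow>
     bl_map B \<in> extensional (bl_set B \<times> bl_set B) \<and>
     nondeg_symmetric_set (bl_set B) (bl_map B) \<and>
     bl_ident B \<in> extensional (ret_set (bl_set B) (bl_map B)) \<and>
     bij_betw (bl_ident B) (ret_set (bl_set B) (bl_map B)) X \<and>
     homomorphism (ret_set (bl_set B) (bl_map B)) (ret_map (bl_set B) (bl_map B)) X S (bl_ident B)"

definition blowup_mor :: "('y, 'x) blowup \<Rightarrow> ('y, 'x) blowup \<Rightarrow> ('y \<Rightarrow> 'y) set" where
  "blowup_mor B1 B2 =
     {h \<in> bl_set B1 \<rightarrow>\<^sub>E bl_set B2.
        homomorphism (bl_set B1) (bl_map B1) (bl_set B2) (bl_map B2) h \<and>
        (\<forall>y\<in>bl_set B1. bl_ident B2 (ret_class (bl_set B2) (bl_map B2) (h y)) =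
                       bl_ident B1 (ret_class (bl_set B1) (bl_map B1) y))}"

definition BL :: "'x set \<Rightarrow> ('x \<times> 'x \<Rightarrow> 'x \<times> 'x) \<Rightarrow> (('y, 'x) blowup, 'y \<Rightarrow> 'y) cat" where
  "BL X S =
     \<lparr>Obj = {B. is_blowup X S B},
      Mor = blowup_mor,
      Idt = (\<lambda>B. \<lambda>y\<in>bl_set B. y),
      Cmp = (\<lambda>A B D g f. compose (bl_set A) g f)\<rparr>"

section \<open>Equivariant bundles\<close>

record ('y, 'x, 'g) equivariant_bundle =
  tot_space :: "'y set"
  proj :: "'y \<Rightarrow> 'x"
  bact :: "'g \<Rightarrow> 'y \<Rightarrow> 'y"

definition is_bundle :: "'x set \<Rightarrow> 'g monoid \<Rightarrow> ('g \<Rightarrow> 'x \<Rightarrow> 'x) \<Rightarrow> ('y, 'x, 'g) equivariant_bundle \<Rightarrow> bool" where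
  "is_bundle X G \<alpha> E \<longleftrightarrow>
     proj E \<in> extensional (tot_space E) \<and> proj E ` tot_space E = X \<and>
     bact E \<in> extensional (carrier G) \<and> group_action G (tot_space E) (bact E) \<and>
     (\<forall>g\<in>carrier G. \<forall>y\<in>tot_space E. proj E (bact E g y) = \<alpha> g (proj E y))"

definition bundle_mor :: "'g monoid \<Rightarrow> ('y, 'x, 'g) equivariant_bundle \<Rightarrow> ('y, 'x, 'g) equivariant_bundle \<Rightarrow> ('y \<Rightarrow> 'y) set" where
  "bundle_mor G E1 E2 =
     {h \<in> tot_space E1 \<rightarrow>\<^sub>E tot_space E2.
        (\<forall>y\<in>tot_space E1. proj E2 (h y) = proj E1 y) \<and>
        (\<forall>g\<in>carrier G. \<forall>y\<in>tot_space E1. h (bact E1 g y) = bact E2 g (h y))}"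

definition Bun ::
  "'x set \<Rightarrow> 'g monoid \<Rightarrow> ('g \<Rightarrow> 'x \<Rightarrow> 'x) \<Rightarrow> (('y, 'x, 'g) equivariant_bundle, 'y \<Rightarrow> 'y) cat" where
  "Bun X G \<alpha> =
     \<lparr>Obj = {E. is_bundle X G \<alpha> E},
      Mor = bundle_mor G,
      Idt = (\<lambda>E. \<lambda>y\<in>tot_space E. y),
      Cmp = (\<lambda>A B D g f. compose (tot_space A) g f)\<rparr>"

definition faithful_bundle ::
  "'x set \<Rightarrow> ('x \<times> 'x \<Rightarrow> 'x \<times> 'x) \<Rightarrow> ('y, 'x, ('x \<times> bool) list set) equivariant_bundle \<Rightarrow> bool" where
  "faithful_bundle X S E \<longleftrightarrow>
     (\<forall>x\<in>X. \<forall>y\<in>X. x \<noteq> y \<longrightarrow> bact E (generator X S x) \<noteq> bact E (generator X S y))"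

definition Bun_f ::
  "'x set \<Rightarrow> ('x \<times> 'x \<Rightarrow> 'x \<times> 'x)
    \<Rightarrow> (('y, 'x, ('x \<times> bool) list set) equivariant_bundle, 'y \<Rightarrow> 'y) cat" where
  "Bun_f X S = full_subcategory (Bun X (structure_group X S) (structure_action X S)) (faithful_bundle X S)"

section \<open>Isomorphism classes\<close>

definition iso_classes :: "('o, 'm) cat \<Rightarrow> ('o \<Rightarrow> bool) \<Rightarrow> 'o set set" where
  "iso_classes C P = {A \<in> Obj C. P A} // iso_rel C"

text \<open>The map of isomorphism classes induced by a functor into \<open>D\<close>, $[A] \mapsto [F A]$.\<close>

definition on_iso_class :: "('p, 'q) cat \<Rightarrow> ('o, 'm, 'p, 'q) cat_functor \<Rightarrow> 'o set \<Rightarrow> 'p set" where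
  "on_iso_class D F K = iso_rel D `` (on_obj F ` K)"

end

theory Submission
  imports Defs
begin

text \<open>The equivalence is in fact an isomorphism of categories: blow-ups and faithful bundles are
  the same data on the same total space \<open>Y\<close>, written in two ways.

  In an involutive solution \<open>T\<close> the second component of \<open>T (x, y)\<close> determines the first, since
  \<open>g x y\<close> is the inverse of \<open>f (f y x)\<close> applied to \<open>y\<close>.  So \<open>T\<close> amounts to the family of
  permutations \<open>f y\<close> of \<open>Y\<close>, and in a blow-up of \<open>(X, S)\<close> this family depends only on the image
  \<open>p y\<close> in \<open>X\<close>, because passing to the retraction identifies exactly the points with equal \<open>f\<close>.
  The braid relation says \<open>f y \<circ> f x = f (f y x) \<circ> f (g x y)\<close>; for the inverse permutations this
  is the defining relation of the structure group.  By the universal property (\<open>lift_hom\<close>,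
  \<open>lift_gen\<close>) the permutations therefore extend to an action on \<open>Y\<close>, which covers the action on
  \<open>X\<close> since \<open>p\<close> is a homomorphism, and is faithful on \<open>X\<close> since \<open>p\<close> identifies any two points
  with equal \<open>f\<close>.

  Conversely, an action \<open>\<rho>\<close> on a bundle gives \<open>f y = \<rho> (p y)\<^sup>-\<^sup>1\<close>, and \<open>g\<close> is then forced.
  Each of the three components of the braid relation on \<open>Y\<close> becomes an identity in the structure
  group, evaluated at the corresponding triple of points of \<open>X\<close> (\<open>braided_T\<close>).  Faithfulness
  says that the classes of the retraction relation are the fibres of \<open>p\<close>, which makes the
  retraction isomorphic to \<open>X\<close>.

  Both constructions undo each other because an action is determined by the generators, and
  a map over \<open>X\<close> is a homomorphism of blow-ups iff it commutes with all \<open>f y\<close>, that is, iff it is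
  equivariant.  The correspondence of isomorphism classes follows, and it preserves the size
  because the total space does not change.

  The notion shared by both sides is that of a \<open>retraction_map\<close>: a surjective homomorphism of
  symmetric sets whose fibres are the classes of the retraction relation.\<close>

section \<open>Words and the structure group\<close>

lemma group_words_simps [simp]:
  "[] \<in> group_words X"
  "(a # w) \<in> group_words X \<longleftrightarrow> fst a \<in> X \<and> w \<in> group_words X"
  "u @ v \<in> group_words X \<longleftrightarrow> u \<in> group_words X \<and> v \<in> group_words X"
  by (cases a; auto simp: group_words_def)+

definition inverse_word :: "('a \<times> bool) list \<Rightarrow> ('a \<times> bool) list" where
  "inverse_word w = rev (map (\<lambda>(x, b). (x, \<not> b)) w)"

lemma inverse_word_Cons: "inverse_word (a # w) = inverse_word w @ [(fst a, \<not> snd a)]"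
  by (cases a) (simp add: inverse_word_def)

lemma inverse_word_closed: "w \<in> group_words X \<Longrightarrow> inverse_word w \<in> group_words X"
  by (induction w) (auto simp: inverse_word_Cons, simp add: inverse_word_def)

locale quadratic_set =
  fixes X :: "'a set" and S :: "'a \<times> 'a \<Rightarrow> 'a \<times> 'a"
  assumes closed: "x \<in> X \<Longrightarrow> y \<in> X \<Longrightarrow> S (x, y) \<in> X \<times> X"
begin

abbreviation "words \<equiv> group_words X"
abbreviation "cls \<equiv> word_class X S"
abbreviation "G\<^sub>X \<equiv> structure_group X S"
abbreviation "gen \<equiv> generator X S"

lemma word_eq_words: "word_eq X S u v \<Longrightarrow> u \<in> words \<and> v \<in> words"
  by (induction rule: word_eq.induct) (use closed in force)+

lemma word_eq_append_left: "word_eq X S u v \<Longrightarrow> w \<in> words \<Longrightarrow> word_eq X S (w @ u) (w @ v)"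
proof (induction rule: word_eq.induct)
  case (cancel u v x b)
  then show ?case using word_eq.cancel[of "w @ u" X v x S b] by simp
next
  case (relation u v x y t z)
  then show ?case using word_eq.relation[of "w @ u" X v x y S t z] by simp
next
  case (sym u v)
  then show ?case by (blast intro: word_eq.sym)
next
  case (trans u v w)
  then show ?case by (blast intro: word_eq.trans)
qed (simp add: word_eq.refl)

lemma word_eq_append_right: "word_eq X S u v \<Longrightarrow> w \<in> words \<Longrightarrow> word_eq X S (u @ w) (v @ w)"
proof (induction rule: word_eq.induct)
  case (cancel u v x b)
  then show ?case using word_eq.cancel[of u X "v @ w" x S b] by simp
next
  case (relation u v x y t z)
  then show ?case using word_eq.relation[of u X "v @ w" x y S t z] by simp
next
  case (sym u v)
  then show ?case by (blast intro: word_eq.sym)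
next
  case (trans u v w)
  then show ?case by (blast intro: word_eq.trans)
qed (simp add: word_eq.refl)

lemma word_eq_append: "word_eq X S u u' \<Longrightarrow> word_eq X S v v' \<Longrightarrow> word_eq X S (u @ v) (u' @ v')"
  by (meson word_eq.trans word_eq_append_left word_eq_append_right word_eq_words)

lemma cls_eq: "word_eq X S u v \<Longrightarrow> cls u = cls v"
  unfolding word_class_def by (blast intro: word_eq.sym word_eq.trans)

lemma mem_cls: "u \<in> words \<Longrightarrow> u \<in> cls u"
  by (simp add: word_class_def word_eq.refl)

lemma cls_carrier [simp]: "u \<in> words \<Longrightarrow> cls u \<in> carrier G\<^sub>X"
  by (simp add: structure_group_def)

lemma carrierE:
  assumes "A \<in> carrier G\<^sub>X" obtains u where "u \<in> words" "A = cls u"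
  using assms by (auto simp: structure_group_def)

lemma gen_carrier [simp]: "x \<in> X \<Longrightarrow> gen x \<in> carrier G\<^sub>X"
  by (simp add: generator_def)

lemma mult_cls:
  assumes "u \<in> words" "v \<in> words"
  shows "cls u \<otimes>\<^bsub>G\<^sub>X\<^esub> cls v = cls (u @ v)"
proof -
  have "cls (u' @ v') = cls (u @ v)" if "u' \<in> cls u" "v' \<in> cls v" for u' v'
    using that unfolding word_class_def mem_Collect_eq
    by (intro cls_eq[unfolded word_class_def] word_eq.sym[OF word_eq_append])
  then have "(\<Union>u'\<in>cls u. \<Union>v'\<in>cls v. cls (u' @ v')) = cls (u @ v)"
    using mem_cls[OF assms(1)] mem_cls[OF assms(2)] by blast
  then show ?thesis by (simp add: structure_group_def)
qed

text \<open>Cancellation takes place in the middle, between the last letter of the inverse word and the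
  first letter of the word.\<close>
lemma inverse_word_cancel: "w \<in> words \<Longrightarrow> word_eq X S (inverse_word w @ w) []"
proof (induction w)
  case Nil
  then show ?case by (simp add: inverse_word_def word_eq.refl)
next
  case (Cons a w)
  obtain x b where a: "a = (x, b)" by (cases a)
  have "word_eq X S (inverse_word w @ [(x, \<not> b), (x, \<not> \<not> b)] @ w) (inverse_word w @ w)"
    using Cons.prems a by (intro word_eq.cancel) (auto intro: inverse_word_closed)
  then have "word_eq X S (inverse_word (a # w) @ a # w) (inverse_word w @ w)"
    using a by (simp add: inverse_word_Cons)
  then show ?case by (rule word_eq.trans) (use Cons in simp)
qed

lemma group_structure_group: "group G\<^sub>X"
proof (rule groupI)
  have one: "\<one>\<^bsub>G\<^sub>X\<^esub> = cls []" by (simp add: structure_group_def)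
  show "\<one>\<^bsub>G\<^sub>X\<^esub> \<in> carrier G\<^sub>X" by (simp add: one)
  fix A assume A: "A \<in> carrier G\<^sub>X"
  then obtain u where u: "u \<in> words" "A = cls u" by (rule carrierE)
  show "\<one>\<^bsub>G\<^sub>X\<^esub> \<otimes>\<^bsub>G\<^sub>X\<^esub> A = A" using u by (simp add: one mult_cls)
  have "cls (inverse_word u) \<otimes>\<^bsub>G\<^sub>X\<^esub> A = \<one>\<^bsub>G\<^sub>X\<^esub>"
    using u by (simp add: one mult_cls inverse_word_closed cls_eq inverse_word_cancel)
  then show "\<exists>B\<in>carrier G\<^sub>X. B \<otimes>\<^bsub>G\<^sub>X\<^esub> A = \<one>\<^bsub>G\<^sub>X\<^esub>"
    using u by (meson cls_carrier inverse_word_closed)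
  fix B assume "B \<in> carrier G\<^sub>X"
  then obtain v where v: "v \<in> words" "B = cls v" by (rule carrierE)
  show "A \<otimes>\<^bsub>G\<^sub>X\<^esub> B \<in> carrier G\<^sub>X" using u v by (simp add: mult_cls)
  fix C assume "C \<in> carrier G\<^sub>X"
  then obtain w where w: "w \<in> words" "C = cls w" by (rule carrierE)
  show "A \<otimes>\<^bsub>G\<^sub>X\<^esub> B \<otimes>\<^bsub>G\<^sub>X\<^esub> C = A \<otimes>\<^bsub>G\<^sub>X\<^esub> (B \<otimes>\<^bsub>G\<^sub>X\<^esub> C)" using u v w by (simp add: mult_cls)
qed

sublocale GX: group G\<^sub>X by (rule group_structure_group)

lemma generator_relation:
  assumes "x \<in> X" "y \<in> X" "S (x, y) = (t, z)"
  shows "gen x \<otimes>\<^bsub>G\<^sub>X\<^esub> gen y = gen t \<otimes>\<^bsub>G\<^sub>X\<^esub> gen z"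
proof -
  have "t \<in> X" "z \<in> X" using closed[OF assms(1,2)] assms(3) by auto
  moreover have "word_eq X S ([] @ [(x, True), (y, True)] @ []) ([] @ [(t, True), (z, True)] @ [])"
    by (rule word_eq.relation) (use assms in auto)
  ultimately show ?thesis using assms by (simp add: generator_def mult_cls cls_eq)
qed

lemma cls_letter:
  assumes "x \<in> X"
  shows "cls [(x, b)] = (if b then gen x else inv\<^bsub>G\<^sub>X\<^esub> (gen x))"
proof (cases b)
  case False
  have "word_eq X S ([] @ [(x, False), (x, \<not> False)] @ []) ([] @ [])"
    by (rule word_eq.cancel) (use assms in auto)
  then have "cls [(x, False)] \<otimes>\<^bsub>G\<^sub>X\<^esub> gen x = \<one>\<^bsub>G\<^sub>X\<^esub>"
    using assms by (simp add: generator_def mult_cls cls_eq) (simp add: structure_group_def)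
  then show ?thesis using assms False by (simp add: GX.inv_equality)
qed (simp add: generator_def)

lemma structure_group_induct [consumes 1, case_names one gen inv_gen]:
  assumes "g \<in> carrier G\<^sub>X"
    and "P \<one>\<^bsub>G\<^sub>X\<^esub>"
    and gen: "\<And>x g. x \<in> X \<Longrightarrow> g \<in> carrier G\<^sub>X \<Longrightarrow> P g \<Longrightarrow> P (gen x \<otimes>\<^bsub>G\<^sub>X\<^esub> g)"
    and inv: "\<And>x g. x \<in> X \<Longrightarrow> g \<in> carrier G\<^sub>X \<Longrightarrow> P g \<Longrightarrow> P (inv\<^bsub>G\<^sub>X\<^esub> (gen x) \<otimes>\<^bsub>G\<^sub>X\<^esub> g)"
  shows "P g"
proof -
  have "P (cls w)" if "w \<in> words" for w
    using that
  proof (induction w)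
    case Nil
    then show ?case using assms(2) by (simp add: structure_group_def)
  next
    case (Cons a w)
    obtain x b where a: "a = (x, b)" by (cases a)
    then have "cls (a # w) = cls [(x, b)] \<otimes>\<^bsub>G\<^sub>X\<^esub> cls w" using Cons.prems by (simp add: mult_cls)
    then show ?case using Cons a gen[of x "cls w"] inv[of x "cls w"]
      by (simp add: cls_letter split: if_splits)
  qed
  then show ?thesis using assms(1) by (metis carrierE)
qed

subsection \<open>The universal property\<close>

text \<open>Well defined on classes under the relations assumed below; off the carrier \<open>lift\<close> is
  \<open>undefined\<close>, since the action of a bundle has to be extensional.\<close>
definition word_value :: "('b, 'c) monoid_scheme \<Rightarrow> ('a \<Rightarrow> 'b) \<Rightarrow> ('a \<times> bool) list \<Rightarrow> 'b" where
  "word_value H \<phi> w =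
     foldr (\<lambda>(x, b) a. (if b then \<phi> x else inv\<^bsub>H\<^esub> (\<phi> x)) \<otimes>\<^bsub>H\<^esub> a) w \<one>\<^bsub>H\<^esub>"

definition lift :: "('b, 'c) monoid_scheme \<Rightarrow> ('a \<Rightarrow> 'b) \<Rightarrow> ('a \<times> bool) list set \<Rightarrow> 'b" where
  "lift H \<phi> = (\<lambda>A \<in> carrier G\<^sub>X. word_value H \<phi> (SOME w. w \<in> A))"

context
  fixes H :: "('b, 'c) monoid_scheme" (structure) and \<phi> :: "'a \<Rightarrow> 'b"
  assumes H: "group H"
    and \<phi>: "\<And>x. x \<in> X \<Longrightarrow> \<phi> x \<in> carrier H"
    and relations: "\<And>x y t z. x \<in> X \<Longrightarrow> y \<in> X \<Longrightarrow> S (x, y) = (t, z) \<Longrightarrow> \<phi> x \<otimes> \<phi> y = \<phi> t \<otimes> \<phi> z"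
begin

interpretation H: group H by (rule H)

lemma word_value_Nil: "word_value H \<phi> [] = \<one>"
  and word_value_Cons: "word_value H \<phi> ((x, b) # w) = (if b then \<phi> x else inv (\<phi> x)) \<otimes> word_value H \<phi> w"
  by (simp_all add: word_value_def)

lemma word_value_closed: "w \<in> words \<Longrightarrow> word_value H \<phi> w \<in> carrier H"
proof (induction w)
  case (Cons a w)
  then show ?case using \<phi>[of "fst a"] by (cases a) (simp add: word_value_Cons)
qed (simp add: word_value_Nil)

lemma word_value_append:
  "u \<in> words \<Longrightarrow> v \<in> words \<Longrightarrow> word_value H \<phi> (u @ v) = word_value H \<phi> u \<otimes> word_value H \<phi> v"
proof (induction u)
  case Nil
  then show ?case using word_value_closed[of v] by (simp add: word_value_Nil)
next
  case (Cons a u)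
  obtain x b where a: "a = (x, b)" by (cases a)
  have x: "(if b then \<phi> x else inv (\<phi> x)) \<in> carrier H" using Cons.prems a \<phi>[of x] by simp
  show ?case
    using Cons H.m_assoc[OF x word_value_closed word_value_closed, of u v]
    by (simp add: word_value_Cons a)
qed

lemma word_value_eq: "word_eq X S u v \<Longrightarrow> word_value H \<phi> u = word_value H \<phi> v"
proof (induction rule: word_eq.induct)
  case (cancel u v x b)
  have "word_value H \<phi> [(x, b), (x, \<not> b)] = \<one>"
    using \<phi>[OF cancel(3)] by (simp add: word_value_Cons word_value_Nil)
  then have "word_value H \<phi> ([(x, b), (x, \<not> b)] @ v) = word_value H \<phi> v"
    using cancel word_value_append[of "[(x, b), (x, \<not> b)]" v] word_value_closed[of v] by simp
  moreover have "word_value H \<phi> (u @ [(x, b), (x, \<not> b)] @ v)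
      = word_value H \<phi> u \<otimes> word_value H \<phi> ([(x, b), (x, \<not> b)] @ v)"
    by (rule word_value_append) (use cancel in auto)
  ultimately show ?case using cancel by (simp add: word_value_append)
next
  case (relation u v x y t z)
  have tz: "t \<in> X" "z \<in> X" using closed[OF relation(3,4)] relation(5) by auto
  have two: "word_value H \<phi> (u @ [(a, True), (b, True)] @ v)
      = word_value H \<phi> u \<otimes> ((\<phi> a \<otimes> \<phi> b) \<otimes> word_value H \<phi> v)" if "a \<in> X" "b \<in> X" for a b
  proof -
    have "word_value H \<phi> [(a, True), (b, True)] = \<phi> a \<otimes> \<phi> b"
      using \<phi>[OF that(1)] \<phi>[OF that(2)] by (simp add: word_value_Cons word_value_Nil)
    moreover have "word_value H \<phi> (u @ [(a, True), (b, True)] @ v)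
        = word_value H \<phi> u \<otimes> word_value H \<phi> ([(a, True), (b, True)] @ v)"
      by (rule word_value_append) (use that relation in auto)
    moreover have "word_value H \<phi> ([(a, True), (b, True)] @ v)
        = word_value H \<phi> [(a, True), (b, True)] \<otimes> word_value H \<phi> v"
      by (rule word_value_append) (use that relation in auto)
    ultimately show ?thesis by simp
  qed
  show ?case unfolding two[OF relation(3,4)] two[OF tz] relations[OF relation(3-5)] ..
qed (simp_all only:)

lemma lift_cls: "w \<in> words \<Longrightarrow> lift H \<phi> (cls w) = word_value H \<phi> w"
proof -
  assume w: "w \<in> words"
  then have "(SOME v. v \<in> cls w) \<in> cls w" by (rule someI[of "\<lambda>v. v \<in> cls w", OF mem_cls])
  then have "word_value H \<phi> (SOME v. v \<in> cls w) = word_value H \<phi> w"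
    unfolding word_class_def by (simp add: word_value_eq)
  then show ?thesis using w by (simp add: lift_def)
qed

lemma lift_hom: "lift H \<phi> \<in> hom G\<^sub>X H"
proof (rule homI)
  fix A assume "A \<in> carrier G\<^sub>X"
  then show "lift H \<phi> A \<in> carrier H" by (auto elim!: carrierE simp: lift_cls word_value_closed)
next
  fix A B assume "A \<in> carrier G\<^sub>X" "B \<in> carrier G\<^sub>X"
  then show "lift H \<phi> (A \<otimes>\<^bsub>G\<^sub>X\<^esub> B) = lift H \<phi> A \<otimes> lift H \<phi> B"
    by (auto elim!: carrierE simp: mult_cls lift_cls word_value_append)
qed

lemma lift_gen: "x \<in> X \<Longrightarrow> lift H \<phi> (gen x) = \<phi> x"
  using \<phi>[of x] by (simp add: generator_def lift_cls word_value_Cons word_value_Nil)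

end

subsection \<open>Actions of the structure group\<close>

text \<open>All properties of bundles that are quantified over the structure group are reduced by this
  lemma to the generators, where they are statements about the maps \<open>f\<close>.\<close>
lemma equivariant_on_generators:
  assumes \<rho>: "group_action G\<^sub>X Y \<rho>" and \<alpha>: "group_action G\<^sub>X Z \<alpha>" and h: "h \<in> Y \<rightarrow> Z"
    and gen: "\<And>x y. x \<in> X \<Longrightarrow> y \<in> Y \<Longrightarrow> h (\<rho> (gen x) y) = \<alpha> (gen x) (h y)"
    and "g \<in> carrier G\<^sub>X" "y \<in> Y"
  shows "h (\<rho> g y) = \<alpha> g (h y)"
proof -
  interpret R: group_action G\<^sub>X Y \<rho> by (rule \<rho>)
  interpret A: group_action G\<^sub>X Z \<alpha> by (rule \<alpha>)
  have hZ: "h y \<in> Z" if "y \<in> Y" for y using h that by auto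
  from \<open>g \<in> carrier G\<^sub>X\<close> \<open>y \<in> Y\<close> show ?thesis
  proof (induction arbitrary: y rule: structure_group_induct)
    case one
    then show ?case using hZ by (simp flip: R.id_eq_one A.id_eq_one)
  next
    case (gen x g)
    then show ?case using hZ assms(4)[OF gen(1)]
      by (simp add: R.composition_rule A.composition_rule R.element_image)
  next
    case (inv_gen x g)
    \<comment> \<open>Apply the hypothesis for the generator itself at the preimage \<open>u\<close> and solve for \<open>h u\<close>.\<close>
    define u where "u = \<rho> (inv\<^bsub>G\<^sub>X\<^esub> (gen x)) (\<rho> g y)"
    have u: "u \<in> Y" "\<rho> (gen x) u = \<rho> g y"
      using inv_gen R.element_image[OF _ _ HOL.refl] R.orbit_sym_aux[of "inv\<^bsub>G\<^sub>X\<^esub> (gen x)" "\<rho> g y" u]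
      by (auto simp: u_def)
    then have "\<alpha> (gen x) (h u) = \<alpha> g (h y)"
      using assms(4)[OF inv_gen(1) u(1)] inv_gen by simp
    then have "h u = \<alpha> (inv\<^bsub>G\<^sub>X\<^esub> (gen x)) (\<alpha> g (h y))"
      using A.orbit_sym_aux[of "gen x" "h u"] hZ[OF u(1)] inv_gen by simp
    then show ?case using inv_gen hZ
      by (simp add: R.composition_rule A.composition_rule u_def)
  qed
qed

text \<open>The case \<open>h = id\<close> of the preceding lemma.\<close>
lemma action_eqI:
  assumes \<rho>: "group_action G\<^sub>X Y \<rho>" "\<rho> \<in> extensional (carrier G\<^sub>X)"
    and \<sigma>: "group_action G\<^sub>X Y \<sigma>" "\<sigma> \<in> extensional (carrier G\<^sub>X)"
    and gen: "\<And>x y. x \<in> X \<Longrightarrow> y \<in> Y \<Longrightarrow> \<rho> (gen x) y = \<sigma> (gen x) y"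
  shows "\<rho> = \<sigma>"
proof (rule extensionalityI[OF \<rho>(2) \<sigma>(2)])
  fix g assume g: "g \<in> carrier G\<^sub>X"
  show "\<rho> g = \<sigma> g"
  proof (rule extensionalityI)
    show "\<rho> g \<in> extensional Y" "\<sigma> g \<in> extensional Y"
      using group_action.bij_prop0[OF \<rho>(1) g] group_action.bij_prop0[OF \<sigma>(1) g]
      by (auto simp: Bij_def)
    show "\<rho> g y = \<sigma> g y" if "y \<in> Y" for y
      using equivariant_on_generators[OF \<rho>(1) \<sigma>(1), of "\<lambda>y. y"] gen g that by auto
  qed
qed

end

section \<open>Nondegenerate symmetric sets\<close>

definition inverse_fmap :: "'a set \<Rightarrow> ('a \<times> 'a \<Rightarrow> 'a \<times> 'a) \<Rightarrow> 'a \<Rightarrow> 'a \<Rightarrow> 'a" where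
  "inverse_fmap X S x = (\<lambda>z\<in>X. inv_into X (fmap S x) z)"

lemma S_eq: "S (x, y) = (gmap S x y, fmap S y x)"
  by (simp add: gmap_def fmap_def)

lemma homomorphism_iff:
  "homomorphism X S Y T h \<longleftrightarrow> h \<in> X \<rightarrow> Y \<and> (\<forall>x\<in>X. \<forall>y\<in>X.
     h (gmap S x y) = gmap T (h x) (h y) \<and> h (fmap S y x) = fmap T (h y) (h x))"
  by (auto simp: homomorphism_def S_eq[of S] S_eq[of T])

lemma braided_iff:
  "braided X S \<longleftrightarrow> (\<forall>x\<in>X. \<forall>y\<in>X. \<forall>z\<in>X.
     gmap S (gmap S x y) (gmap S (fmap S y x) z) = gmap S x (gmap S y z) \<and>
     fmap S (gmap S (fmap S y x) z) (gmap S x y) = gmap S (fmap S (gmap S y z) x) (fmap S z y) \<and>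
     fmap S z (fmap S y x) = fmap S (fmap S z y) (fmap S (gmap S y z) x))"
  by (simp add: braided_def S12_def S23_def S_eq)

lemma carrier_BijGroup: "carrier (BijGroup Y) = Bij Y"
  by (simp add: BijGroup_def)

lemma BijGroup_mult: "\<sigma> \<in> Bij Y \<Longrightarrow> \<tau> \<in> Bij Y \<Longrightarrow> \<sigma> \<otimes>\<^bsub>BijGroup Y\<^esub> \<tau> = compose Y \<sigma> \<tau>"
  by (simp add: BijGroup_def)

lemma BijGroup_mult_apply:
  "\<sigma> \<in> Bij Y \<Longrightarrow> \<tau> \<in> Bij Y \<Longrightarrow> y \<in> Y \<Longrightarrow> (\<sigma> \<otimes>\<^bsub>BijGroup Y\<^esub> \<tau>) y = \<sigma> (\<tau> y)"
  by (simp add: BijGroup_def compose_def)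

lemma BijGroup_eqI:
  assumes "\<sigma> \<in> Bij Y" "\<tau> \<in> Bij Y" "\<And>y. y \<in> Y \<Longrightarrow> \<sigma> y = \<tau> y"
  shows "\<sigma> = \<tau>"
  by (rule extensionalityI[of _ Y]) (use assms in \<open>auto simp: Bij_def\<close>)

locale symmetric_set =
  fixes X :: "'a set" and S :: "'a \<times> 'a \<Rightarrow> 'a \<times> 'a"
  assumes nondeg_symmetric: "nondeg_symmetric_set X S"
begin

abbreviation "f \<equiv> fmap S"
abbreviation "g \<equiv> gmap S"
abbreviation "perm \<equiv> inverse_fmap X S"

sublocale quadratic_set X S
  by unfold_locales
    (use nondeg_symmetric in \<open>auto simp: nondeg_symmetric_set_def bij_betw_def\<close>)

lemma f_bij: "x \<in> X \<Longrightarrow> bij_betw (f x) X X" and g_bij: "x \<in> X \<Longrightarrow> bij_betw (g x) X X"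
  using nondeg_symmetric by (auto simp: nondeg_symmetric_set_def nondegenerate_def)

lemma f_closed [simp]: "x \<in> X \<Longrightarrow> y \<in> X \<Longrightarrow> f x y \<in> X"
  and g_closed [simp]: "x \<in> X \<Longrightarrow> y \<in> X \<Longrightarrow> g x y \<in> X"
  using f_bij g_bij by (auto dest: bij_betwE)

lemma f_inj: "x \<in> X \<Longrightarrow> y \<in> X \<Longrightarrow> z \<in> X \<Longrightarrow> f x y = f x z \<longleftrightarrow> y = z"
  and g_inj: "x \<in> X \<Longrightarrow> y \<in> X \<Longrightarrow> z \<in> X \<Longrightarrow> g x y = g x z \<longleftrightarrow> y = z"
  using f_bij[of x] g_bij[of x] by (auto simp: bij_betw_def dest: inj_onD)

lemma f_f_g [simp]: "x \<in> X \<Longrightarrow> y \<in> X \<Longrightarrow> f (f y x) (g x y) = y"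
  and g_g_f [simp]: "x \<in> X \<Longrightarrow> y \<in> X \<Longrightarrow> g (g x y) (f y x) = x"
  using nondeg_symmetric by (auto simp: nondeg_symmetric_set_def involutive_def S_eq)

lemma f_f: "x \<in> X \<Longrightarrow> y \<in> X \<Longrightarrow> z \<in> X \<Longrightarrow> f z (f y x) = f (f z y) (f (g y z) x)"
  using nondeg_symmetric unfolding nondeg_symmetric_set_def braided_iff by blast

lemma perm_Bij: "x \<in> X \<Longrightarrow> perm x \<in> Bij X"
  using bij_betw_inv_into[OF f_bij] by (simp add: inverse_fmap_def Bij_def)

lemma perm_carrier: "x \<in> X \<Longrightarrow> perm x \<in> carrier (BijGroup X)"
  by (simp add: carrier_BijGroup perm_Bij)

lemma perm_closed [simp]: "x \<in> X \<Longrightarrow> z \<in> X \<Longrightarrow> perm x z \<in> X"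
  using perm_Bij[of x] by (auto dest: Bij_imp_funcset)

lemma f_perm [simp]: "x \<in> X \<Longrightarrow> z \<in> X \<Longrightarrow> f x (perm x z) = z"
  by (simp add: inverse_fmap_def bij_betw_inv_into_right[OF f_bij])

lemma perm_f [simp]: "x \<in> X \<Longrightarrow> z \<in> X \<Longrightarrow> perm x (f x z) = z"
  by (simp add: inverse_fmap_def bij_betw_inv_into_left[OF f_bij])

text \<open>Involutivity makes the maps \<open>g\<close> redundant: a solution is determined by its maps \<open>f\<close>.\<close>
lemma g_eq_perm: "x \<in> X \<Longrightarrow> y \<in> X \<Longrightarrow> g x y = perm (f y x) y"
  using perm_f[of "f y x" "g x y"] by simp

text \<open>The third component of the braid relation, inverted; it is the defining relation of the
  structure group for \<open>x \<mapsto> perm x\<close>.\<close>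
lemma perm_perm:
  "x \<in> X \<Longrightarrow> y \<in> X \<Longrightarrow> v \<in> X \<Longrightarrow> perm x (perm y v) = perm (g x y) (perm (f y x) v)"
proof -
  assume xyv: "x \<in> X" "y \<in> X" "v \<in> X"
  define w where "w = perm (g x y) (perm (f y x) v)"
  have w: "w \<in> X" using xyv by (simp add: w_def)
  have "f y (f x w) = v" using f_f[OF w xyv(1,2)] xyv by (simp add: w_def)
  moreover have "perm x (perm y (f y (f x w))) = w" using xyv w by simp
  ultimately show "perm x (perm y v) = perm (g x y) (perm (f y x) v)" unfolding w_def by (simp only:)
qed

lemma perm_relation:
  assumes "x \<in> X" "y \<in> X" "S (x, y) = (t, z)"
  shows "perm x \<otimes>\<^bsub>BijGroup X\<^esub> perm y = perm t \<otimes>\<^bsub>BijGroup X\<^esub> perm z"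
proof -
  interpret B: group "BijGroup X" by (rule group_BijGroup)
  have tz: "t = g x y" "z = f y x" using assms(3) by (auto simp: S_eq)
  show ?thesis unfolding tz
  proof (rule BijGroup_eqI)
    show "perm x \<otimes>\<^bsub>BijGroup X\<^esub> perm y \<in> Bij X"
      "perm (g x y) \<otimes>\<^bsub>BijGroup X\<^esub> perm (f y x) \<in> Bij X"
      using B.m_closed[OF perm_carrier perm_carrier] assms by (simp_all add: carrier_BijGroup)
  qed (use assms perm_perm[OF assms(1,2)] in \<open>simp add: BijGroup_mult_apply perm_Bij\<close>)
qed

text \<open>Identifies the letter-by-letter action on \<open>X\<close> with the homomorphism given by the universal
  property; this shows that it does not depend on the words chosen in the classes.\<close>
lemma structure_action_eq_lift: "structure_action X S = lift (BijGroup X) perm"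
proof -
  interpret B: group "BijGroup X" by (rule group_BijGroup)
  have letter: "letter_act X S (x, b) = (if b then perm x else inv\<^bsub>BijGroup X\<^esub> (perm x))"
    if "x \<in> X" for x b
  proof (cases b)
    case False
    have "(\<lambda>z\<in>X. inv_into X (perm x) z) = (\<lambda>z\<in>X. f x z)"
      by (rule restrict_ext) (use that perm_Bij[OF that] in
        \<open>auto simp: Bij_def bij_betw_def intro!: inv_into_f_eq\<close>)
    then show ?thesis using False inv_BijGroup[OF perm_Bij[OF that]]
      by (simp add: letter_act_def)
  qed (simp add: letter_act_def inverse_fmap_def)
  have word: "word_act X S w = word_value (BijGroup X) perm w" if "w \<in> words" for w
    using that
  proof (induction w)
    case Nil
    then show ?case by (simp add: word_act_def word_value_def BijGroup_def)
  next
    case (Cons a w)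
    obtain x b where a: "a = (x, b)" by (cases a)
    have "word_value (BijGroup X) perm w \<in> carrier (BijGroup X)"
      by (rule word_value_closed[OF group_BijGroup])
        (erule perm_carrier, erule (2) perm_relation, use Cons.prems in simp)
    then have "word_value (BijGroup X) perm w \<in> Bij X" by (simp add: carrier_BijGroup)
    moreover have "letter_act X S (x, b) \<in> Bij X"
      using letter[of x b] perm_carrier[of x] B.inv_closed[of "perm x"] Cons.prems a
      by (simp add: carrier_BijGroup)
    ultimately have "compose X (letter_act X S (x, b)) (word_value (BijGroup X) perm w)
        = letter_act X S (x, b) \<otimes>\<^bsub>BijGroup X\<^esub> word_value (BijGroup X) perm w"
      by (simp add: BijGroup_mult)
    moreover have "word_act X S (a # w) = compose X (letter_act X S (x, b)) (word_act X S w)"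
      by (simp add: word_act_def a)
    moreover have "word_value (BijGroup X) perm (a # w)
        = letter_act X S (x, b) \<otimes>\<^bsub>BijGroup X\<^esub> word_value (BijGroup X) perm w"
      using letter[of x b] Cons.prems by (simp add: word_value_def a)
    moreover have "word_act X S w = word_value (BijGroup X) perm w" using Cons by simp
    ultimately show ?case by (simp only:)
  qed
  have "(SOME w. w \<in> A) \<in> words" if A: "A \<in> carrier G\<^sub>X" for A
  proof -
    obtain u where u: "u \<in> words" "A = cls u" using A by (rule carrierE)
    have "(SOME w. w \<in> A) \<in> A" by (rule someI[of _ u]) (use u mem_cls in simp)
    then have "word_eq X S u (SOME w. w \<in> A)" using u by (simp add: word_class_def)
    then show ?thesis using word_eq_words by blast
  qed
  then show ?thesis unfolding structure_action_def lift_def by (intro restrict_ext) (simp add: word)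
qed

lemma group_action_structure_action: "group_action G\<^sub>X X (structure_action X S)"
  and structure_action_gen: "x \<in> X \<Longrightarrow> structure_action X S (gen x) = perm x"
proof -
  show "group_action G\<^sub>X X (structure_action X S)"
    unfolding structure_action_eq_lift group_action_def
    by (rule group_hom.intro[OF GX.is_group group_BijGroup], rule group_hom_axioms.intro,
        rule lift_hom[OF group_BijGroup perm_carrier perm_relation])
  show "x \<in> X \<Longrightarrow> structure_action X S (gen x) = perm x"
    unfolding structure_action_eq_lift by (rule lift_gen[OF group_BijGroup perm_carrier perm_relation])
qed

subsection \<open>The retraction is well defined\<close>

text \<open>With \<open>D u = perm u u\<close>, this reads \<open>D \<circ> g x = perm x \<circ> D\<close>.  As \<open>D\<close> is injective
  (\<open>perm_self_inj\<close>), \<open>g x\<close> is determined by \<open>f x\<close>, which is what makes the retraction well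
  defined.\<close>
lemma perm_self_g:
  assumes "x \<in> X" "y \<in> X"
  shows "perm (g x y) (g x y) = perm x (perm y y)"
proof -
  have "perm (f y x) y = g x y" using assms by (simp add: g_eq_perm)
  then show ?thesis using perm_perm[of x y y] assms by simp
qed

text \<open>The point \<open>t = perm u u\<close> satisfies \<open>S (t, u) = (t, u)\<close>, so \<open>u\<close> is the solution of
  \<open>g t u = t\<close>.\<close>
lemma perm_self_inj:
  assumes "u \<in> X" "v \<in> X" "perm u u = perm v v"
  shows "u = v"
proof -
  define t where "t = perm u u"
  have t: "t \<in> X" "f u t = u" using assms(1,2) by (simp_all add: t_def)
  have "f v t = v" unfolding t_def assms(3) using assms(2) by simp
  note t = t this
  have "g t u = t" "g t v = t"
    using g_eq_perm[of t u] g_eq_perm[of t v] t assms(1,2) t_def assms(3) by simp_all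
  then show ?thesis using g_inj[of t u v] t assms by simp
qed

lemma perm_cong:
  assumes "\<And>z. z \<in> X \<Longrightarrow> f x z = f x' z" "x \<in> X" "x' \<in> X"
  shows "perm x = perm x'"
  by (rule BijGroup_eqI[OF perm_Bij perm_Bij]) (use assms in \<open>metis f_perm perm_closed perm_f\<close>)+

lemma f_eq_imp_g_eq:
  assumes "\<And>z. z \<in> X \<Longrightarrow> f x z = f x' z" "x \<in> X" "x' \<in> X" "y \<in> X"
  shows "g x y = g x' y"
  by (rule perm_self_inj) (use assms perm_self_g perm_cong[OF assms(1-3)] in auto)

lemma ret_rel_iff: "(x, y) \<in> ret_rel X S \<longleftrightarrow> x \<in> X \<and> y \<in> X \<and> (\<forall>z\<in>X. f x z = f y z)"
  by (simp add: ret_rel_def)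

lemma equiv_ret_rel: "equiv X (ret_rel X S)"
  by (rule equivI) (auto simp: refl_on_def sym_def trans_def ret_rel_iff)

lemma ret_rel_g_f:
  assumes "(x, x') \<in> ret_rel X S" "(y, y') \<in> ret_rel X S"
  shows "(f y x, f y' x') \<in> ret_rel X S" "(g x y, g x' y') \<in> ret_rel X S"
proof -
  note * = assms[unfolded ret_rel_iff]
  have mem: "x \<in> X" "x' \<in> X" "y \<in> X" "y' \<in> X" using * by auto
  have fyx: "f y x = f y' x" using * by auto
  have gxy: "g x' y = g x y" using f_eq_imp_g_eq[of x x' y] * by auto
  \<comment> \<open>Changing \<open>x\<close> alone: \<open>f\<close> of \<open>f y x\<close> is determined by \<open>f y \<circ> f x\<close> and \<open>f\<close> of \<open>g x y\<close>.\<close>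
  have "f (f y x) z = f (f y x') z" if z: "z \<in> X" for z
  proof -
    have "f (f y x) (f (g x y) w) = f (f y x') (f (g x y) w)" if "w \<in> X" for w
      using f_f[of w x y] f_f[of w x' y] * that by (simp add: gxy)
    from this[of "perm (g x y) z"] show ?thesis using z mem by simp
  qed
  then show ff: "(f y x, f y' x') \<in> ret_rel X S" using * by (simp add: ret_rel_iff)
  \<comment> \<open>Changing \<open>y\<close> alone leaves \<open>f y x\<close> unchanged, so \<open>f_f\<close> determines \<open>f\<close> of \<open>g x y\<close>.\<close>
  have "f (g x y) z = f (g x y') z" if z: "z \<in> X" for z
  proof -
    have "f (f y x) (f (g x y) z) = f (f y x) (f (g x y') z)"
      using f_f[of z x y] f_f[of z x y'] * z by (simp add: fyx)
    then show ?thesis using f_inj mem z by simp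
  qed
  moreover have "g x y' = g x' y'" using f_eq_imp_g_eq[of x x' y'] * by auto
  ultimately show "(g x y, g x' y') \<in> ret_rel X S" using mem by (simp add: ret_rel_iff)
qed

lemma ret_map_class:
  assumes "x \<in> X" "y \<in> X"
  shows "ret_map X S (ret_class X S x, ret_class X S y)
    = (ret_class X S (g x y), ret_class X S (f y x))"
proof -
  have "ret_class X S (g x' y') = ret_class X S (g x y) \<and>
        ret_class X S (f y' x') = ret_class X S (f y x)"
    if "x' \<in> ret_class X S x" "y' \<in> ret_class X S y" for x' y'
  proof -
    have "(x, x') \<in> ret_rel X S" "(y, y') \<in> ret_rel X S" using that by auto
    then show ?thesis using equiv_class_eq[OF equiv_ret_rel] ret_rel_g_f by metis
  qed
  moreover have "x \<in> ret_class X S x" "y \<in> ret_class X S y"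
    using assms by (auto simp: ret_rel_iff)
  ultimately have
    "(\<Union>x'\<in>ret_class X S x. \<Union>y'\<in>ret_class X S y. ret_class X S (g x' y')) = ret_class X S (g x y)"
    "(\<Union>x'\<in>ret_class X S x. \<Union>y'\<in>ret_class X S y. ret_class X S (f y' x')) = ret_class X S (f y x)"
    by blast+
  then show ?thesis by (simp add: ret_map_def)
qed

end

section \<open>Retraction maps and the bundles they define\<close>

lemma ret_set_eq_image: "ret_set Y T = ret_class Y T ` Y"
  by (auto simp: ret_set_def quotient_def)

text \<open>The retraction of \<open>(Y, T)\<close>, seen as a quotient map instead of a set of classes.\<close>
locale retraction_map = X: symmetric_set X S + Y: symmetric_set Y T
  for X :: "'x set" and S and Y :: "'y set" and T +
  fixes p :: "'y \<Rightarrow> 'x"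
  assumes surj: "p ` Y = X"
    and hom: "homomorphism Y T X S p"
    and fibre: "a \<in> Y \<Longrightarrow> b \<in> Y \<Longrightarrow> p a = p b \<longleftrightarrow> (\<forall>z\<in>Y. fmap T a z = fmap T b z)"
begin

lemma p_closed [simp]: "y \<in> Y \<Longrightarrow> p y \<in> X"
  using surj by auto

lemma p_f: "x \<in> Y \<Longrightarrow> y \<in> Y \<Longrightarrow> p (Y.f y x) = X.f (p y) (p x)"
  and p_g: "x \<in> Y \<Longrightarrow> y \<in> Y \<Longrightarrow> p (Y.g x y) = X.g (p x) (p y)"
  using hom by (auto simp: homomorphism_iff)

lemma p_perm:
  assumes "x \<in> Y" "y \<in> Y"
  shows "p (Y.perm y x) = X.perm (p y) (p x)"
proof -
  have "p x = X.f (p y) (p (Y.perm y x))" using p_f[of "Y.perm y x" y] assms by simp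
  then show ?thesis using assms by simp
qed

text \<open>The permutation attached to \<open>x\<close> is that of an arbitrary point over \<open>x\<close>; all points in a
  fibre have the same one.\<close>
definition fibre_perm :: "'x \<Rightarrow> 'y \<Rightarrow> 'y" where
  "fibre_perm x = Y.perm (inv_into Y p x)"

lemma fibre_perm [simp]: "y \<in> Y \<Longrightarrow> fibre_perm (p y) = Y.perm y"
proof -
  assume y: "y \<in> Y"
  have "inv_into Y p (p y) \<in> Y" "p (inv_into Y p (p y)) = p y"
    using y by (auto intro: inv_into_into f_inv_into_f)
  then show ?thesis unfolding fibre_perm_def using fibre y by (intro Y.perm_cong) blast+
qed

lemma fibre_perm_carrier: "x \<in> X \<Longrightarrow> fibre_perm x \<in> carrier (BijGroup Y)"
  using surj by (auto simp: carrier_BijGroup Y.perm_Bij)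

lemma fibre_perm_relation:
  assumes "x \<in> X" "y \<in> X" "S (x, y) = (t, z)"
  shows "fibre_perm x \<otimes>\<^bsub>BijGroup Y\<^esub> fibre_perm y = fibre_perm t \<otimes>\<^bsub>BijGroup Y\<^esub> fibre_perm z"
proof -
  obtain a b where ab: "a \<in> Y" "b \<in> Y" "x = p a" "y = p b" using assms surj by auto
  then have "t = p (Y.g a b)" "z = p (Y.f b a)" using assms(3) by (auto simp: S_eq p_f p_g)
  then have "fibre_perm t = Y.perm (Y.g a b)" "fibre_perm z = Y.perm (Y.f b a)"
    using ab by simp_all
  moreover have "fibre_perm x = Y.perm a" "fibre_perm y = Y.perm b" using ab by simp_all
  ultimately show ?thesis using Y.perm_relation[OF ab(1,2) S_eq[of T]] by (simp only:)
qed

abbreviation "fibre_action \<equiv> X.lift (BijGroup Y) fibre_perm"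

lemma group_action_fibre_action: "group_action X.G\<^sub>X Y fibre_action"
  unfolding group_action_def
  by (rule group_hom.intro[OF X.GX.is_group group_BijGroup], rule group_hom_axioms.intro,
      rule X.lift_hom[OF group_BijGroup fibre_perm_carrier fibre_perm_relation])

lemma fibre_action_gen: "y \<in> Y \<Longrightarrow> fibre_action (X.gen (p y)) = Y.perm y"
  proof -
  assume y: "y \<in> Y"
  have "fibre_action (X.gen (p y)) = fibre_perm (p y)"
    by (rule X.lift_gen[OF group_BijGroup])
      (erule fibre_perm_carrier, erule (2) fibre_perm_relation, use y in simp)
  then show ?thesis using y by simp
qed

lemma fibre_action_extensional: "fibre_action \<in> extensional (carrier X.G\<^sub>X)"
  by (simp add: X.lift_def)

text \<open>On the generators this is \<open>p_perm\<close>.\<close>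
lemma p_fibre_action:
  assumes "g \<in> carrier X.G\<^sub>X" "y \<in> Y"
  shows "p (fibre_action g y) = structure_action X S g (p y)"
proof (rule X.equivariant_on_generators[OF group_action_fibre_action X.group_action_structure_action])
  fix x z assume "x \<in> X" "z \<in> Y"
  moreover then obtain a where "a \<in> Y" "x = p a" using surj by auto
  ultimately show "p (fibre_action (X.gen x) z) = structure_action X S (X.gen x) (p z)"
    by (simp add: fibre_action_gen X.structure_action_gen p_perm)
qed (use assms in auto)

text \<open>Generators with the same action come from points with equal \<open>f\<close>, which lie in one fibre
  of \<open>p\<close>; hence the bundle is faithful.\<close>
lemma bundle_of_retraction_map:
  assumes "tot_space E = Y" "proj E = restrict p Y" "bact E = fibre_action"
  shows "is_bundle X X.G\<^sub>X (structure_action X S) E" and "faithful_bundle X S E"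
proof -
  show "is_bundle X X.G\<^sub>X (structure_action X S) E"
    unfolding is_bundle_def assms
  proof (intro conjI ballI)
    fix g y assume gy: "g \<in> carrier X.G\<^sub>X" "y \<in> Y"
    then have "fibre_action g y \<in> Y"
      using group_action.element_image[OF group_action_fibre_action _ _ HOL.refl] by blast
    then show "restrict p Y (fibre_action g y) = structure_action X S g (restrict p Y y)"
      using gy p_fibre_action by simp
  qed (use surj group_action_fibre_action fibre_action_extensional in auto)
  have "p a = p b" if "a \<in> Y" "b \<in> Y" "Y.perm a = Y.perm b" for a b
  proof -
    have "Y.f a z = Y.f b z" if "z \<in> Y" for z
    proof -
      have "Y.f a z = Y.f b (Y.perm b (Y.f a z))" using \<open>a \<in> Y\<close> \<open>b \<in> Y\<close> that by simp
      also have "Y.perm b (Y.f a z) = z"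
        unfolding \<open>Y.perm a = Y.perm b\<close>[symmetric] using \<open>a \<in> Y\<close> that by simp
      finally show ?thesis .
    qed
    then show ?thesis using fibre that by simp
  qed
  then have "fibre_action (X.gen u) \<noteq> fibre_action (X.gen v)" if "u \<in> X" "v \<in> X" "u \<noteq> v" for u v
    using that surj fibre_action_gen by (metis (no_types, lifting) imageE)
  then show "faithful_bundle X S E" by (simp add: faithful_bundle_def assms(3))
qed

subsection \<open>The retraction as a quotient map\<close>

lemma ret_class_eq_fibre: "y \<in> Y \<Longrightarrow> ret_class Y T y = {z \<in> Y. p z = p y}"
  using fibre by (auto simp: ret_rel_def)

lemma the_elem_ret_class: "y \<in> Y \<Longrightarrow> the_elem (p ` ret_class Y T y) = p y"
proof -
  assume "y \<in> Y"
  then have "p ` ret_class Y T y = {p y}" by (auto simp: ret_class_eq_fibre)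
  then show ?thesis by simp
qed

text \<open>Every class of the retraction relation is a fibre of \<open>p\<close>, so the identification with \<open>X\<close>
  sends it to the only element of its image under \<open>p\<close>.\<close>
lemma blowup_of_retraction_map:
  assumes "bl_set B = Y" "bl_map B = T" "T \<in> extensional (Y \<times> Y)"
    and "bl_ident B = (\<lambda>K\<in>ret_set Y T. the_elem (p ` K))"
  shows "is_blowup X S B"
proof -
  have id: "bl_ident B (ret_class Y T y) = p y" if "y \<in> Y" for y
    using that by (simp add: assms ret_set_eq_image the_elem_ret_class)
  have "inj_on (bl_ident B) (ret_set Y T)"
    unfolding ret_set_eq_image
  proof (rule inj_onI, elim imageE)
    fix K L a b assume ab: "a \<in> Y" "b \<in> Y" "K = ret_class Y T a" "L = ret_class Y T b"
      and "bl_ident B K = bl_ident B L"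
    then have "p a = p b" by (simp only: id)
    then show "K = L" using ab by (simp only: ret_class_eq_fibre)
  qed
  moreover have "bl_ident B ` ret_set Y T = X"
    unfolding ret_set_eq_image image_image surj[symmetric] by (rule image_cong) (simp_all only: id)
  ultimately have bij: "bij_betw (bl_ident B) (ret_set Y T) X" by (simp add: bij_betw_def)
  have "map_prod (bl_ident B) (bl_ident B) (ret_map Y T (K, L)) = S (bl_ident B K, bl_ident B L)"
    if KL: "K \<in> ret_set Y T" "L \<in> ret_set Y T" for K L
  proof -
    obtain a where a: "a \<in> Y" "K = ret_class Y T a"
      using KL(1) unfolding ret_set_eq_image by blast
    obtain b where b: "b \<in> Y" "L = ret_class Y T b"
      using KL(2) unfolding ret_set_eq_image by blast
    note ab = a(1) b(1) a(2) b(2)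
    show ?thesis unfolding ab(3,4) Y.ret_map_class[OF ab(1,2)]
      using ab(1,2) by (simp only: map_prod_simp id Y.g_closed Y.f_closed p_f p_g S_eq[of S])
  qed
  then have "homomorphism (ret_set Y T) (ret_map Y T) X S (bl_ident B)"
    using bij by (auto simp: homomorphism_def dest: bij_betwE)
  then show "is_blowup X S B"
    using bij Y.nondeg_symmetric assms by (simp add: is_blowup_def)
qed

end

definition blowup_proj :: "('y, 'x) blowup \<Rightarrow> 'y \<Rightarrow> 'x" where
  "blowup_proj B = (\<lambda>y\<in>bl_set B. bl_ident B (ret_class (bl_set B) (bl_map B) y))"

text \<open>The converse: by \<open>ret_map_class\<close> the quotient map to the retraction is a homomorphism, and
  \<open>blowup_proj\<close> is its composite with the identification.\<close>
lemma retraction_map_blowup_proj: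
  assumes "nondeg_symmetric_set X S" "is_blowup X S B"
  shows "retraction_map X S (bl_set B) (bl_map B) (blowup_proj B)"
proof -
  define Y T where YT: "Y = bl_set B" "T = bl_map B"
  define i where "i = bl_ident B"
  interpret X: symmetric_set X S by unfold_locales (rule assms)
  interpret Y: symmetric_set Y T by unfold_locales (use assms YT in \<open>simp add: is_blowup_def\<close>)
  have bij: "bij_betw i (ret_set Y T) X"
    and hom: "homomorphism (ret_set Y T) (ret_map Y T) X S i"
    using assms(2) by (simp_all add: is_blowup_def YT i_def)
  have p: "blowup_proj B y = i (ret_class Y T y)" if "y \<in> Y" for y
    using that by (simp add: blowup_proj_def YT i_def)
  have mem: "ret_class Y T y \<in> ret_set Y T" if "y \<in> Y" for y
    using that by (simp add: ret_set_def quotientI)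
  have "retraction_map X S Y T (blowup_proj B)"
  proof
    have "X = i ` ret_class Y T ` Y"
      using bij unfolding bij_betw_def ret_set_eq_image by (simp only:)
    also have "\<dots> = blowup_proj B ` Y" unfolding image_image by (rule image_cong) (simp_all add: p)
    finally show surj: "blowup_proj B ` Y = X" ..
    have "map_prod (blowup_proj B) (blowup_proj B) (T (a, b)) = S (blowup_proj B a, blowup_proj B b)"
      if "a \<in> Y" "b \<in> Y" for a b
    proof -
      have "map_prod i i (ret_map Y T (ret_class Y T a, ret_class Y T b))
          = S (i (ret_class Y T a), i (ret_class Y T b))"
        using hom mem[OF that(1)] mem[OF that(2)] by (simp add: homomorphism_def)
      then show ?thesis using that by (simp add: Y.ret_map_class p S_eq[of T])
    qed
    then show "homomorphism Y T X S (blowup_proj B)" using surj by (auto simp: homomorphism_def)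
    fix a b assume ab: "a \<in> Y" "b \<in> Y"
    have "blowup_proj B a = blowup_proj B b \<longleftrightarrow> ret_class Y T a = ret_class Y T b"
      using bij mem ab by (auto simp: p bij_betw_def inj_on_def)
    also have "\<dots> \<longleftrightarrow> (a, b) \<in> ret_rel Y T"
      using eq_equiv_class_iff[OF Y.equiv_ret_rel ab] .
    finally show "blowup_proj B a = blowup_proj B b \<longleftrightarrow> (\<forall>z\<in>Y. fmap T a z = fmap T b z)"
      using ab by (simp add: Y.ret_rel_iff)
  qed
  then show ?thesis by (simp add: YT)
qed

section \<open>The symmetric set of a faithful bundle\<close>

text \<open>The solution with \<open>f y = \<rho> (p y)\<^sup>-\<^sup>1\<close>; the first component is the one forced by involutivity,
  \<open>\<rho> (p (f y x)) y\<close>.\<close>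
definition bundle_map ::
  "'x set \<Rightarrow> ('x \<times> 'x \<Rightarrow> 'x \<times> 'x) \<Rightarrow> ('y, 'x, ('x \<times> bool) list set) equivariant_bundle
    \<Rightarrow> 'y \<times> 'y \<Rightarrow> 'y \<times> 'y" where
  "bundle_map X S E = (\<lambda>(x, y) \<in> tot_space E \<times> tot_space E.
     let z = bact E (inv\<^bsub>structure_group X S\<^esub> (generator X S (proj E y))) x
     in (bact E (generator X S (proj E z)) y, z))"

locale structure_group_bundle = symmetric_set X S
  for X :: "'x set" and S +
  fixes E :: "('y, 'x, ('x \<times> bool) list set) equivariant_bundle"
  assumes is_bundle: "is_bundle X (structure_group X S) (structure_action X S) E"
begin

abbreviation "Y \<equiv> tot_space E"
abbreviation "p \<equiv> proj E"
abbreviation "T \<equiv> bundle_map X S E"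

definition "r a = bact E (gen a)"
definition "r' a = bact E (inv\<^bsub>G\<^sub>X\<^esub> (gen a))"

sublocale E: group_action G\<^sub>X Y "bact E"
  using is_bundle by (simp add: is_bundle_def)

lemma p_closed [simp]: "y \<in> Y \<Longrightarrow> p y \<in> X"
  using is_bundle by (auto simp: is_bundle_def)

lemma p_bact: "h \<in> carrier G\<^sub>X \<Longrightarrow> y \<in> Y \<Longrightarrow> p (bact E h y) = structure_action X S h (p y)"
  using is_bundle by (simp add: is_bundle_def)

lemma r_closed [simp]: "a \<in> X \<Longrightarrow> y \<in> Y \<Longrightarrow> r a y \<in> Y"
  and r'_closed [simp]: "a \<in> X \<Longrightarrow> y \<in> Y \<Longrightarrow> r' a y \<in> Y"
  by (simp_all add: r_def r'_def E.element_image[OF _ _ HOL.refl])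

lemma r'_r [simp]: "a \<in> X \<Longrightarrow> y \<in> Y \<Longrightarrow> r' a (r a y) = y"
  using E.orbit_sym_aux[of "gen a" y] by (simp add: r_def r'_def)

lemma r_r' [simp]: "a \<in> X \<Longrightarrow> y \<in> Y \<Longrightarrow> r a (r' a y) = y"
  using E.orbit_sym_aux[of "inv\<^bsub>G\<^sub>X\<^esub> (gen a)" y] by (simp add: r_def r'_def)

lemma p_r [simp]: "a \<in> X \<Longrightarrow> y \<in> Y \<Longrightarrow> p (r a y) = perm a (p y)"
  by (simp add: r_def p_bact structure_action_gen)

lemma p_r' [simp]: "a \<in> X \<Longrightarrow> y \<in> Y \<Longrightarrow> p (r' a y) = f a (p y)"
  using p_r[of a "r' a y"] f_perm[of a "p (r' a y)"] perm_f[of a "p (r' a y)"] by simp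

lemma r_relation:
  assumes "a \<in> X" "b \<in> X" "y \<in> Y"
  shows "r a (r b y) = r (g a b) (r (f b a) y)"
  using generator_relation[OF assms(1,2) S_eq[of S]] assms
  by (simp add: r_def flip: E.composition_rule)

lemma r'_relation:
  assumes "a \<in> X" "b \<in> X" "y \<in> Y"
  shows "r' b (r' a y) = r' (f b a) (r' (g a b) y)"
proof -
  define v where "v = r' (f b a) (r' (g a b) y)"
  have v: "v \<in> Y" using assms by (simp add: v_def)
  have "r a (r b v) = y" unfolding r_relation[OF assms(1,2) v] unfolding v_def using assms by simp
  then have "r' b (r' a y) = r' b (r' a (r a (r b v)))" by simp
  also have "\<dots> = v" using assms(1,2) v by simp
  finally show ?thesis by (simp only: v_def)
qed

lemma fmap_T [simp]: "x \<in> Y \<Longrightarrow> y \<in> Y \<Longrightarrow> fmap T y x = r' (p y) x"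
  by (simp add: fmap_def bundle_map_def r'_def Let_def)

lemma gmap_T: "x \<in> Y \<Longrightarrow> y \<in> Y \<Longrightarrow> gmap T x y = r (f (p y) (p x)) y"
  using p_r'[of "p y" x] by (simp add: gmap_def bundle_map_def r'_def r_def Let_def)

lemma p_gmap_T [simp]: "x \<in> Y \<Longrightarrow> y \<in> Y \<Longrightarrow> p (gmap T x y) = g (p x) (p y)"
  by (simp add: gmap_T g_eq_perm)

lemma gmap_T_closed [simp]: "x \<in> Y \<Longrightarrow> y \<in> Y \<Longrightarrow> gmap T x y \<in> Y"
  by (simp add: gmap_T)

text \<open>Both sides of the braid relation move the points \<open>z\<close>, \<open>y\<close>, \<open>x\<close> to the three positions by
  elements of the structure group that depend only on the images \<open>a\<close>, \<open>b\<close>, \<open>c\<close> in \<open>X\<close>.  The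
  braid relation of \<open>X\<close> and the relations of the group show that these elements agree.\<close>
lemma braided_T: "braided Y T"
  unfolding braided_iff
proof (intro ballI conjI)
  fix x y z assume xyz: "x \<in> Y" "y \<in> Y" "z \<in> Y"
  define a b c where abc: "a = p x" "b = p y" "c = p z"
  then have X: "a \<in> X" "b \<in> X" "c \<in> X" using xyz by auto
  have br: "f (g (f b a) c) (g a b) = g (f (g b c) a) (f c b)" "f c (f b a) = f (f c b) (f (g b c) a)"
    using nondeg_symmetric X unfolding nondeg_symmetric_set_def braided_iff by blast+
  show "gmap T (gmap T x y) (gmap T (fmap T y x) z) = gmap T x (gmap T y z)"
  proof -
    have "gmap T (gmap T x y) (gmap T (fmap T y x) z)
        = r (f (p (gmap T (fmap T y x) z)) (p (gmap T x y))) (gmap T (fmap T y x) z)"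
      using xyz by (intro gmap_T) auto
    also have "p (gmap T (fmap T y x) z) = g (f b a) c" using xyz by (simp add: abc)
    also have "p (gmap T x y) = g a b" using xyz by (simp add: abc)
    also have w: "gmap T (fmap T y x) z = r (f c (f b a)) z" using xyz by (simp add: gmap_T abc)
    also have "r (f (g (f b a) c) (g a b)) (r (f c (f b a)) z) = r (f (g b c) a) (r (f c b) z)"
      using r_relation[of "f (g b c) a" "f c b" z] X xyz by (simp add: br)
    also have "r (f c b) z = gmap T y z" using xyz by (simp add: gmap_T abc)
    also have "r (f (g b c) a) (gmap T y z) = gmap T x (gmap T y z)"
      using xyz by (simp add: gmap_T[of x "gmap T y z"] abc)
    finally show ?thesis unfolding w .
  qed
  show "fmap T (gmap T (fmap T y x) z) (gmap T x y) = gmap T (fmap T (gmap T y z) x) (fmap T z y)"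
  proof -
    \<comment> \<open>For \<open>v\<close> the required identity is a relation between positive words in the generators.\<close>
    define v where "v = r' c y"
    have v: "v \<in> Y" "r c v = y" using xyz X by (auto simp: v_def abc)
    have "r (f b a) (r c v) = r (g (f b a) c) (r (f c (f b a)) v)"
      using X v by (intro r_relation) auto
    then have "r' (g (f b a) c) (r (f b a) y) = r (f c (f b a)) v"
      using X v by simp
    moreover have "fmap T (gmap T (fmap T y x) z) (gmap T x y) = r' (g (f b a) c) (r (f b a) y)"
      using xyz by (simp add: abc gmap_T[of x y])
    moreover have "gmap T (fmap T (gmap T y z) x) (fmap T z y) = r (f (f c b) (f (g b c) a)) v"
      using xyz gmap_T[of "fmap T (gmap T y z) x" "fmap T z y"] by (simp add: abc v_def)
    ultimately show ?thesis by (simp only: br)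
  qed
  show "fmap T z (fmap T y x) = fmap T (fmap T z y) (fmap T (gmap T y z) x)"
    using xyz r'_relation[of b c x] X by (simp flip: abc)
qed

lemma nondeg_symmetric_T: "nondeg_symmetric_set Y T"
proof -
  have inv: "T (T (x, y)) = (x, y)" and cl: "T (x, y) \<in> Y \<times> Y" if "x \<in> Y" "y \<in> Y" for x y
  proof -
    show "T (x, y) \<in> Y \<times> Y" using that by (simp add: S_eq[of T])
    have 1: "fmap T (fmap T y x) (gmap T x y) = y" using that by (simp add: gmap_T)
    have "gmap T (gmap T x y) (fmap T y x) = r (f (p (fmap T y x)) (p (gmap T x y))) (fmap T y x)"
      using that by (intro gmap_T) auto
    also have "\<dots> = x" using that by simp
    finally show "T (T (x, y)) = (x, y)" using 1 by (simp only: S_eq[of T])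
  qed
  have "bij_betw T (Y \<times> Y) (Y \<times> Y)"
  proof (rule bij_betw_byWitness[where f' = T])
    show "T ` (Y \<times> Y) \<subseteq> Y \<times> Y" "T ` (Y \<times> Y) \<subseteq> Y \<times> Y"
      by (intro image_subsetI, erule SigmaE, simp only: cl)+
  qed (use inv in auto)
  moreover have "bij_betw (fmap T y) Y Y" if "y \<in> Y" for y
    by (rule bij_betw_byWitness[where f' = "r (p y)"]) (use that in auto)
  moreover have "bij_betw (gmap T x) Y Y" if x: "x \<in> Y" for x
  proof (rule bij_betwI')
    fix y z assume yz: "y \<in> Y" "z \<in> Y"
    show "gmap T x y = gmap T x z \<longleftrightarrow> y = z"
    proof
      assume eq: "gmap T x y = gmap T x z"
      have "p y = p z" using arg_cong[OF eq, of p] x yz by (simp add: g_inj)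
      then have "r' (f (p y) (p x)) (r (f (p y) (p x)) y) = r' (f (p y) (p x)) (r (f (p y) (p x)) z)"
        using eq x yz by (simp add: gmap_T)
      then show "y = z" using x yz by simp
    qed simp
  next
    fix w assume w: "w \<in> Y"
    \<comment> \<open>A preimage of \<open>w\<close> lies over the preimage \<open>b\<close> of \<open>p w\<close>, and \<open>b\<close> fixes the group element
      that has to be undone.\<close>
    obtain b where b: "b \<in> X" "g (p x) b = p w"
      using g_bij[of "p x"] x w by (metis bij_betw_iff_bijections p_closed)
    have "p (r' (f b (p x)) w) = b" using x w b f_f_g[of "p x" b] by simp
    then have "gmap T x (r' (f b (p x)) w) = w" using x w b by (simp add: gmap_T)
    then show "\<exists>y\<in>Y. w = gmap T x y" using x w b by (metis f_closed p_closed r'_closed)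
  qed (use x in simp)
  moreover have "Y \<noteq> {}"
    using is_bundle nondeg_symmetric by (auto simp: is_bundle_def nondeg_symmetric_set_def)
  ultimately show ?thesis
    using inv braided_T by (simp add: nondeg_symmetric_set_def nondegenerate_def involutive_def)
qed

lemma retraction_map_proj:
  assumes "faithful_bundle X S E"
  shows "retraction_map X S Y T p"
proof
  show "nondeg_symmetric_set Y T" by (rule nondeg_symmetric_T)
  show "p ` Y = X" using is_bundle by (simp add: is_bundle_def)
  show "homomorphism Y T X S p" by (auto simp: homomorphism_iff)
  fix a b assume ab: "a \<in> Y" "b \<in> Y"
  show "p a = p b \<longleftrightarrow> (\<forall>z\<in>Y. fmap T a z = fmap T b z)"
  proof
    assume eq: "\<forall>z\<in>Y. fmap T a z = fmap T b z"
    have "r (p a) = r (p b)"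
    proof (rule BijGroup_eqI)
      show "r (p a) \<in> Bij Y" "r (p b) \<in> Bij Y" using ab by (simp_all add: r_def E.bij_prop0)
      fix z assume z: "z \<in> Y"
      have "r (p a) z = r (p a) (r' (p b) (r (p b) z))" using ab z by simp
      also have "\<dots> = r (p a) (r' (p a) (r (p b) z))"
        using eq[rule_format, of "r (p b) z"] ab z by simp
      also have "\<dots> = r (p b) z" using ab z by simp
      finally show "r (p a) z = r (p b) z" .
    qed
    then show "p a = p b"
      using assms ab unfolding faithful_bundle_def r_def by (meson p_closed)
  qed (use ab in simp)
qed

end

section \<open>Isomorphisms of categories\<close>

lemma functor_preserves_iso:
  assumes F: "is_functor C D F" and "A \<in> Obj C" "B \<in> Obj C" "is_iso C A B f"
  shows "is_iso D (on_obj F A) (on_obj F B) (on_mor F A B f)"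
proof -
  obtain g where g: "f \<in> Mor C A B" "g \<in> Mor C B A"
    "Cmp C A B A g f = Idt C A" "Cmp C B A B f g = Idt C B"
    using assms(4) by (auto simp: is_iso_def)
  let ?g = "on_mor F B A g"
  have mor: "on_mor F A B f \<in> Mor D (on_obj F A) (on_obj F B)"
    "?g \<in> Mor D (on_obj F B) (on_obj F A)"
    using F assms(2,3) g by (auto simp: is_functor_def)
  have "Cmp D (on_obj F A) (on_obj F B) (on_obj F A) ?g (on_mor F A B f)
      = on_mor F A A (Cmp C A B A g f)"
    "Cmp D (on_obj F B) (on_obj F A) (on_obj F B) (on_mor F A B f) ?g
      = on_mor F B B (Cmp C B A B f g)"
    using F assms(2,3) g(1,2) unfolding is_functor_def by metis+
  moreover have "on_mor F A A (Idt C A) = Idt D (on_obj F A)"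
    "on_mor F B B (Idt C B) = Idt D (on_obj F B)"
    using F assms(2,3) unfolding is_functor_def by metis+
  ultimately show ?thesis using mor g by (auto simp: is_iso_def)
qed

lemma identity_is_iso: "is_category C \<Longrightarrow> A \<in> Obj C \<Longrightarrow> is_iso C A A (Idt C A)"
  unfolding is_iso_def is_category_def by blast

lemma is_functor_identity: "is_category C \<Longrightarrow> is_functor C C identity_functor"
  by (simp add: is_functor_def identity_functor_def is_category_def)

lemma equiv_iso_rel:
  assumes C: "is_category C"
  shows "equiv (Obj C) (iso_rel C)"
proof (rule equivI)
  show "iso_rel C \<subseteq> Obj C \<times> Obj C" by (auto simp: iso_rel_def)
  show "refl_on (Obj C) (iso_rel C)"
    using identity_is_iso[OF C] by (auto simp: iso_rel_def refl_on_def)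
  show "sym (iso_rel C)" by (auto simp: iso_rel_def sym_def is_iso_def)
  show "trans (iso_rel C)"
  proof (rule transI)
    fix A B D assume "(A, B) \<in> iso_rel C" "(B, D) \<in> iso_rel C"
    then obtain f g where obj: "A \<in> Obj C" "B \<in> Obj C" "D \<in> Obj C"
      and "is_iso C A B f" "is_iso C B D g" by (auto simp: iso_rel_def)
    then obtain f' g' where
      f: "f \<in> Mor C A B" "f' \<in> Mor C B A" "Cmp C A B A f' f = Idt C A" "Cmp C B A B f f' = Idt C B" and
      g: "g \<in> Mor C B D" "g' \<in> Mor C D B" "Cmp C B D B g' g = Idt C B" "Cmp C D B D g g' = Idt C D"
      by (auto simp: is_iso_def)
    have cmp: "Cmp C P Q R v u \<in> Mor C P R"
      if "P \<in> Obj C" "Q \<in> Obj C" "R \<in> Obj C" "u \<in> Mor C P Q" "v \<in> Mor C Q R" for P Q R u v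
      using C that unfolding is_category_def by blast
    have assoc: "Cmp C P R Q w (Cmp C P U R v u) = Cmp C P U Q (Cmp C U R Q w v) u"
      if "P \<in> Obj C" "U \<in> Obj C" "R \<in> Obj C" "Q \<in> Obj C"
        "u \<in> Mor C P U" "v \<in> Mor C U R" "w \<in> Mor C R Q" for P U R Q u v w
      using C that unfolding is_category_def by blast
    have unit: "Cmp C P Q Q (Idt C Q) u = u"
      if "P \<in> Obj C" "Q \<in> Obj C" "u \<in> Mor C P Q" for P Q u
      using C that unfolding is_category_def by blast
    have inner: "Cmp C P Q R v' (Cmp C P R Q v u) = u"
      if "P \<in> Obj C" "Q \<in> Obj C" "R \<in> Obj C" "u \<in> Mor C P R" "v \<in> Mor C R Q" "v' \<in> Mor C Q R"
        "Cmp C R Q R v' v = Idt C R" for P Q R u v v'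
      using assoc[OF that(1,3,2,3,4,5,6)] that unit by simp
    \<comment> \<open>\<open>f' \<circ> g'\<close> is a two-sided inverse of \<open>g \<circ> f\<close>.\<close>
    have "Cmp C A D A (Cmp C D B A f' g') (Cmp C A B D g f) = Idt C A"
      using assoc[OF obj(1,3,2,1) cmp[OF obj f(1) g(1)] g(2) f(2)]
        inner[OF obj(1,3,2) f(1) g(1,2,3)] f(3) by simp
    moreover have "Cmp C D A D (Cmp C A B D g f) (Cmp C D B A f' g') = Idt C D"
      using assoc[OF obj(3,1,2,3) cmp[OF obj(3,2,1) g(2) f(2)] f(1) g(1)]
        inner[OF obj(3,1,2) g(2) f(2,1,4)] g(4) by simp
    ultimately have "is_iso C A D (Cmp C A B D g f)"
      using cmp[OF obj f(1) g(1)] cmp[OF obj(3,2,1) g(2) f(2)] by (auto simp: is_iso_def)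
    then show "(A, D) \<in> iso_rel C" using obj by (auto simp: iso_rel_def)
  qed
qed

text \<open>Mutually inverse functors on the nose, on objects and on morphisms.\<close>
locale category_isomorphism =
  fixes C :: "('o, 'm) cat" and D :: "('p, 'q) cat"
    and F :: "('o, 'm, 'p, 'q) cat_functor" and G :: "('p, 'q, 'o, 'm) cat_functor"
  assumes F: "is_functor C D F" and G: "is_functor D C G"
    and GF_obj: "\<And>A. A \<in> Obj C \<Longrightarrow> on_obj G (on_obj F A) = A"
    and FG_obj: "\<And>A. A \<in> Obj D \<Longrightarrow> on_obj F (on_obj G A) = A"
    and GF_mor: "\<And>A B f. A \<in> Obj C \<Longrightarrow> B \<in> Obj C \<Longrightarrow> f \<in> Mor C A B \<Longrightarrow>
      on_mor G (on_obj F A) (on_obj F B) (on_mor F A B f) = f"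
    and FG_mor: "\<And>A B f. A \<in> Obj D \<Longrightarrow> B \<in> Obj D \<Longrightarrow> f \<in> Mor D A B \<Longrightarrow>
      on_mor F (on_obj G A) (on_obj G B) (on_mor G A B f) = f"
begin

lemma inverse: "category_isomorphism D C G F"
  by unfold_locales (use F G GF_obj FG_obj GF_mor FG_mor in auto)

lemma category: "is_category C"
  using F by (simp add: is_functor_def)

lemma F_obj: "A \<in> Obj C \<Longrightarrow> on_obj F A \<in> Obj D"
  using F by (simp add: is_functor_def)

lemma G_obj: "A \<in> Obj D \<Longrightarrow> on_obj G A \<in> Obj C"
  using G by (simp add: is_functor_def)

text \<open>On the category itself the composite functor and the identity functor have equal values,
  so the identity morphisms form a natural isomorphism.\<close>
lemma natural_iso:
  "is_natural_iso C C identity_functor (composite_functor G F) (Idt C)"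
  "is_natural_iso C C (composite_functor G F) identity_functor (Idt C)"
proof -
  note cat = category[unfolded is_category_def]
  have GF: "is_functor C C (composite_functor G F)"
    using category cat unfolding is_functor_def composite_functor_def
    by (simp add: GF_obj GF_mor)
  show "is_natural_iso C C identity_functor (composite_functor G F) (Idt C)"
    using GF is_functor_identity[OF category] identity_is_iso[OF category] cat
    unfolding is_natural_iso_def identity_functor_def composite_functor_def
    by (simp add: GF_obj GF_mor)
  show "is_natural_iso C C (composite_functor G F) identity_functor (Idt C)"
    using GF is_functor_identity[OF category] identity_is_iso[OF category] cat
    unfolding is_natural_iso_def identity_functor_def composite_functor_def
    by (simp add: GF_obj GF_mor)
qed

theorem equivalence: "is_equivalence C D F"
  unfolding is_equivalence_def
  using F G natural_iso(1) category_isomorphism.natural_iso(2)[OF inverse] by blast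

text \<open>The functor \<open>F\<close> preserves isomorphisms, and its inverse \<open>G\<close> reflects them back.\<close>
lemma iso_rel_iff:
  assumes "A \<in> Obj C" "B \<in> Obj C"
  shows "(on_obj F A, on_obj F B) \<in> iso_rel D \<longleftrightarrow> (A, B) \<in> iso_rel C"
proof
  assume "(A, B) \<in> iso_rel C"
  then show "(on_obj F A, on_obj F B) \<in> iso_rel D"
    using functor_preserves_iso[OF F assms] F_obj assms by (auto simp: iso_rel_def)
next
  assume "(on_obj F A, on_obj F B) \<in> iso_rel D"
  then obtain f where "is_iso D (on_obj F A) (on_obj F B) f" by (auto simp: iso_rel_def)
  from functor_preserves_iso[OF G F_obj F_obj this] assms
  show "(A, B) \<in> iso_rel C" by (auto simp: iso_rel_def GF_obj)
qed

lemma on_iso_class_class: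
  assumes "A \<in> Obj C"
  shows "on_iso_class D F (iso_rel C `` {A}) = iso_rel D `` {on_obj F A}"
proof -
  have D: "equiv (Obj D) (iso_rel D)"
    using F by (intro equiv_iso_rel) (simp add: is_functor_def)
  have "A \<in> iso_rel C `` {A}"
    using equiv_class_self[OF equiv_iso_rel[OF category] assms] .
  moreover have "iso_rel D `` {on_obj F B} = iso_rel D `` {on_obj F A}" if "B \<in> iso_rel C `` {A}" for B
  proof -
    have "(A, B) \<in> iso_rel C" "B \<in> Obj C" using that by (auto simp: iso_rel_def)
    then have "(on_obj F A, on_obj F B) \<in> iso_rel D" using iso_rel_iff assms by blast
    then show ?thesis using equiv_class_eq[OF D] by blast
  qed
  ultimately show ?thesis unfolding on_iso_class_def by blast
qed

theorem bij_betw_iso_classes: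
  assumes PQ: "\<And>A. A \<in> Obj C \<Longrightarrow> Q (on_obj F A) \<longleftrightarrow> P A"
  shows "bij_betw (on_iso_class D F) (iso_classes C P) (iso_classes D Q)"
proof -
  have C: "equiv (Obj C) (iso_rel C)" by (rule equiv_iso_rel[OF category])
  have D: "equiv (Obj D) (iso_rel D)"
    using F by (intro equiv_iso_rel) (simp add: is_functor_def)
  have classes: "iso_classes E R = (\<lambda>A. iso_rel E `` {A}) ` {A \<in> Obj E. R A}"
    for E :: "('u, 'v) cat" and R by (auto simp: iso_classes_def quotient_def)
  have "inj_on (on_iso_class D F) (iso_classes C P)"
    unfolding classes
  proof (rule inj_onI, elim imageE)
    fix K L A B assume AB: "A \<in> {A \<in> Obj C. P A}" "B \<in> {A \<in> Obj C. P A}"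
      and KL: "K = iso_rel C `` {A}" "L = iso_rel C `` {B}"
      and "on_iso_class D F K = on_iso_class D F L"
    then have "iso_rel D `` {on_obj F A} = iso_rel D `` {on_obj F B}"
      using on_iso_class_class by simp
    then have "(on_obj F A, on_obj F B) \<in> iso_rel D"
      using eq_equiv_class_iff[OF D] F_obj AB by simp
    then have "(A, B) \<in> iso_rel C" using iso_rel_iff AB by simp
    then show "K = L" using equiv_class_eq[OF C] KL by simp
  qed
  moreover have "{B \<in> Obj D. Q B} = on_obj F ` {A \<in> Obj C. P A}"
  proof (intro equalityI subsetI)
    fix B assume B: "B \<in> {B \<in> Obj D. Q B}"
    then have "B = on_obj F (on_obj G B)" "on_obj G B \<in> Obj C" by (simp_all add: FG_obj G_obj)
    moreover from this have "P (on_obj G B)" using B PQ[of "on_obj G B"] by simp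
    ultimately show "B \<in> on_obj F ` {A \<in> Obj C. P A}" by (intro image_eqI) simp_all
  qed (use PQ F_obj in auto)
  then have "on_iso_class D F ` iso_classes C P = iso_classes D Q"
    unfolding classes by (simp add: image_image on_iso_class_class cong: image_cong_simp)
  ultimately show ?thesis by (simp add: bij_betw_def)
qed

end

section \<open>Blow-ups and faithful bundles\<close>

definition bundle_of_blowup ::
  "'x set \<Rightarrow> ('x \<times> 'x \<Rightarrow> 'x \<times> 'x) \<Rightarrow> ('y, 'x) blowup
    \<Rightarrow> ('y, 'x, ('x \<times> bool) list set) equivariant_bundle" where
  "bundle_of_blowup X S B =
     \<lparr>tot_space = bl_set B, proj = blowup_proj B,
      bact = quadratic_set.lift X S (BijGroup (bl_set B))
        (retraction_map.fibre_perm (bl_set B) (bl_map B) (blowup_proj B))\<rparr>"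

definition blowup_of_bundle ::
  "'x set \<Rightarrow> ('x \<times> 'x \<Rightarrow> 'x \<times> 'x) \<Rightarrow> ('y, 'x, ('x \<times> bool) list set) equivariant_bundle
    \<Rightarrow> ('y, 'x) blowup" where
  "blowup_of_bundle X S E =
     \<lparr>bl_set = tot_space E, bl_map = bundle_map X S E,
      bl_ident = (\<lambda>K\<in>ret_set (tot_space E) (bundle_map X S E). the_elem (proj E ` K))\<rparr>"

context symmetric_set
begin

abbreviation "faithful_bundle_obj E \<equiv>
  is_bundle X G\<^sub>X (structure_action X S) E \<and> faithful_bundle X S E"

lemma bundle_of_blowup_obj:
  assumes "is_blowup X S B"
  shows "faithful_bundle_obj (bundle_of_blowup X S B)"
proof -
  interpret R: retraction_map X S "bl_set B" "bl_map B" "blowup_proj B"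
    by (rule retraction_map_blowup_proj[OF nondeg_symmetric assms])
  have "restrict (blowup_proj B) (bl_set B) = blowup_proj B" by (simp add: blowup_proj_def)
  then show ?thesis
    using R.bundle_of_retraction_map[of "bundle_of_blowup X S B"] by (simp add: bundle_of_blowup_def)
qed

lemma blowup_of_bundle_obj:
  assumes "faithful_bundle_obj E"
  shows "is_blowup X S (blowup_of_bundle X S E)"
    and "blowup_proj (blowup_of_bundle X S E) = proj E"
proof -
  interpret E: structure_group_bundle X S E
    by unfold_locales (use assms in blast)
  interpret R: retraction_map X S "tot_space E" "bundle_map X S E" "proj E"
    by (rule E.retraction_map_proj) (use assms in blast)
  have ext: "bundle_map X S E \<in> extensional (tot_space E \<times> tot_space E)"
    by (simp add: bundle_map_def)
  show "is_blowup X S (blowup_of_bundle X S E)"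
    by (rule R.blowup_of_retraction_map) (simp_all add: blowup_of_bundle_def ext)
  show "blowup_proj (blowup_of_bundle X S E) = proj E"
  proof (rule extensionalityI)
    show "proj E \<in> extensional (tot_space E)" using assms by (simp add: is_bundle_def)
    show "blowup_proj (blowup_of_bundle X S E) \<in> extensional (tot_space E)"
      by (simp add: blowup_proj_def blowup_of_bundle_def)
    fix y assume "y \<in> tot_space E"
    then show "blowup_proj (blowup_of_bundle X S E) y = proj E y"
      by (simp add: blowup_proj_def blowup_of_bundle_def ret_set_eq_image R.the_elem_ret_class)
  qed
qed

text \<open>The solution of the blow-up is recovered because the generator \<open>p y\<close> acts as the inverse
  of \<open>f y\<close>, and \<open>g_eq_perm\<close> gives the first component.\<close>
lemma blowup_of_bundle_of_blowup:
  fixes B :: "('y, 'a) blowup"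
  assumes B: "is_blowup X S B"
  shows "blowup_of_bundle X S (bundle_of_blowup X S B) = B"
proof -
  let ?Y = "bl_set B" and ?T = "bl_map B" and ?E = "bundle_of_blowup X S B"
  interpret R: retraction_map X S ?Y ?T "blowup_proj B"
    by (rule retraction_map_blowup_proj[OF nondeg_symmetric B])
  interpret E: structure_group_bundle X S ?E
    by unfold_locales (use bundle_of_blowup_obj[OF B] in blast)
  have sel: "tot_space ?E = ?Y" "proj ?E = blowup_proj B" "bact ?E = R.fibre_action"
    by (simp_all add: bundle_of_blowup_def)
  have r: "E.r (blowup_proj B y) = R.Y.perm y" if "y \<in> ?Y" for y
    using that by (simp add: E.r_def sel R.fibre_action_gen)
  have r': "E.r' (blowup_proj B y) x = R.Y.f y x" if "x \<in> ?Y" "y \<in> ?Y" for x y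
    using that E.r'_r[of "blowup_proj B y" "R.Y.f y x"] by (simp add: r sel)
  have T: "bundle_map X S ?E = ?T"
  proof (rule extensionalityI)
    show "bundle_map X S ?E \<in> extensional (?Y \<times> ?Y)" by (simp add: bundle_map_def sel)
    show "?T \<in> extensional (?Y \<times> ?Y)" using B by (simp add: is_blowup_def)
    fix w assume "w \<in> ?Y \<times> ?Y"
    then obtain x y where w: "w = (x, y)" "x \<in> ?Y" "y \<in> ?Y" by auto
    have "fmap (bundle_map X S ?E) y x = R.Y.f y x" using E.fmap_T[of x y] w by (simp add: sel r')
    moreover have "gmap (bundle_map X S ?E) x y = R.Y.g x y"
      using E.gmap_T[of x y] w r[of "R.Y.f y x"] R.p_f[of x y] R.Y.g_eq_perm[of x y]
      unfolding sel by (simp only: R.Y.f_closed)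
    ultimately show "bundle_map X S ?E w = ?T w" by (simp only: w(1) S_eq)
  qed
  have id: "(\<lambda>K\<in>ret_set ?Y ?T. the_elem (blowup_proj B ` K)) = bl_ident B"
  proof (rule extensionalityI[of _ "ret_set ?Y ?T"])
    show "bl_ident B \<in> extensional (ret_set ?Y ?T)" using B by (simp add: is_blowup_def)
    fix K assume K: "K \<in> ret_set ?Y ?T"
    then obtain y where "y \<in> ?Y" "K = ret_class ?Y ?T y" unfolding ret_set_eq_image by blast
    then show "(\<lambda>K\<in>ret_set ?Y ?T. the_elem (blowup_proj B ` K)) K = bl_ident B K"
      using K R.the_elem_ret_class[of y] by (simp add: blowup_proj_def)
  qed simp
  have "blowup_of_bundle X S ?E = \<lparr>bl_set = ?Y, bl_map = ?T,
      bl_ident = \<lambda>K\<in>ret_set ?Y ?T. the_elem (blowup_proj B ` K)\<rparr>"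
    unfolding blowup_of_bundle_def T by (simp only: sel)
  also have "\<dots> = B" unfolding id by simp
  finally show ?thesis .
qed

text \<open>Both actions are the inverse of \<open>f a\<close> on the generator \<open>p a\<close>, so they coincide.\<close>
lemma bundle_of_blowup_of_bundle:
  assumes E: "faithful_bundle_obj E"
  shows "bundle_of_blowup X S (blowup_of_bundle X S E) = E"
proof -
  interpret E: structure_group_bundle X S E by unfold_locales (use E in blast)
  interpret R: retraction_map X S "tot_space E" "bundle_map X S E" "proj E"
    by (rule E.retraction_map_proj) (use E in blast)
  have "R.fibre_action = bact E"
  proof (rule action_eqI[OF R.group_action_fibre_action R.fibre_action_extensional])
    show "group_action G\<^sub>X (tot_space E) (bact E)" "bact E \<in> extensional (carrier G\<^sub>X)"
      using E by (simp_all add: is_bundle_def)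
    fix x y assume xy: "x \<in> X" "y \<in> tot_space E"
    then obtain a where a: "a \<in> tot_space E" "x = proj E a" using R.surj by auto
    have "R.Y.perm a (R.Y.f a (E.r x y)) = E.r x y" using a xy by (intro R.Y.perm_f) auto
    then have "R.Y.perm a y = E.r x y" using a xy by simp
    then show "R.fibre_action (gen x) y = bact E (gen x) y"
      using a by (simp add: R.fibre_action_gen E.r_def)
  qed
  then show ?thesis
    unfolding bundle_of_blowup_def blowup_of_bundle_obj(2)[OF E] by (simp add: blowup_of_bundle_def)
qed

text \<open>A map over \<open>X\<close> is a homomorphism iff it commutes with the maps \<open>f\<close>, the maps \<open>g\<close> being
  determined by them; commuting with the inverses of the \<open>f\<close> is equivariance on generators.\<close>
lemma blowup_mor_eq_bundle_mor:
  assumes B1: "is_blowup X S B1" and B2: "is_blowup X S B2"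
  shows "blowup_mor B1 B2 = bundle_mor G\<^sub>X (bundle_of_blowup X S B1) (bundle_of_blowup X S B2)"
proof -
  let ?Y1 = "bl_set B1" and ?Y2 = "bl_set B2" and ?p1 = "blowup_proj B1" and ?p2 = "blowup_proj B2"
  interpret R1: retraction_map X S ?Y1 "bl_map B1" ?p1
    by (rule retraction_map_blowup_proj[OF nondeg_symmetric B1])
  interpret R2: retraction_map X S ?Y2 "bl_map B2" ?p2
    by (rule retraction_map_blowup_proj[OF nondeg_symmetric B2])
  have "homomorphism ?Y1 (bl_map B1) ?Y2 (bl_map B2) h \<longleftrightarrow>
      (\<forall>a\<in>carrier G\<^sub>X. \<forall>y\<in>?Y1. h (R1.fibre_action a y) = R2.fibre_action a (h y))"
    if h: "h \<in> ?Y1 \<rightarrow> ?Y2" and p: "\<forall>y\<in>?Y1. ?p2 (h y) = ?p1 y" for h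
  proof
    have hY: "h y \<in> ?Y2" if "y \<in> ?Y1" for y using h that by auto
    assume "homomorphism ?Y1 (bl_map B1) ?Y2 (bl_map B2) h"
    then have hf: "h (R1.Y.f y x) = R2.Y.f (h y) (h x)" if "x \<in> ?Y1" "y \<in> ?Y1" for x y
      using that by (simp add: homomorphism_iff)
    show "\<forall>a\<in>carrier G\<^sub>X. \<forall>y\<in>?Y1. h (R1.fibre_action a y) = R2.fibre_action a (h y)"
    proof (intro ballI, rule equivariant_on_generators[OF R1.group_action_fibre_action
          R2.group_action_fibre_action h])
      fix x y assume xy: "x \<in> X" "y \<in> ?Y1"
      then obtain a where a: "a \<in> ?Y1" "x = ?p1 a" using R1.surj by auto
      have 1: "R1.fibre_action (gen x) = R1.Y.perm a" using a by (simp add: R1.fibre_action_gen)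
      have 2: "R2.fibre_action (gen x) = R2.Y.perm (h a)"
        using a p hY R2.fibre_action_gen[of "h a"] by simp
      have "R2.Y.f (h a) (h (R1.Y.perm a y)) = h y" using hf[of "R1.Y.perm a y" a] a xy by simp
      then have "R2.Y.perm (h a) (R2.Y.f (h a) (h (R1.Y.perm a y))) = R2.Y.perm (h a) (h y)" by simp
      then show "h (R1.fibre_action (gen x) y) = R2.fibre_action (gen x) (h y)"
        unfolding 1 2 using a xy hY by simp
    qed
  next
    have hY: "h y \<in> ?Y2" if "y \<in> ?Y1" for y using h that by auto
    assume eq: "\<forall>a\<in>carrier G\<^sub>X. \<forall>y\<in>?Y1. h (R1.fibre_action a y) = R2.fibre_action a (h y)"
    have hperm: "h (R1.Y.perm a y) = R2.Y.perm (h a) (h y)" if "a \<in> ?Y1" "y \<in> ?Y1" for a y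
      using eq[rule_format, of "gen (?p1 a)" y] that p hY R1.fibre_action_gen[of a]
        R2.fibre_action_gen[of "h a"] by simp
    have hf: "h (R1.Y.f y x) = R2.Y.f (h y) (h x)" if xy: "x \<in> ?Y1" "y \<in> ?Y1" for x y
    proof -
      have "h x = R2.Y.perm (h y) (h (R1.Y.f y x))" using hperm[of y "R1.Y.f y x"] xy by simp
      then have "R2.Y.f (h y) (h x) = R2.Y.f (h y) (R2.Y.perm (h y) (h (R1.Y.f y x)))" by simp
      then show ?thesis using xy hY by simp
    qed
    have hg: "h (R1.Y.g x y) = R2.Y.g (h x) (h y)" if "x \<in> ?Y1" "y \<in> ?Y1" for x y
      using that hY by (simp add: R1.Y.g_eq_perm R2.Y.g_eq_perm hperm hf)
    show "homomorphism ?Y1 (bl_map B1) ?Y2 (bl_map B2) h"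
      using h hf hg by (simp add: homomorphism_iff)
  qed
  note equivariant = this
  have over: "(\<forall>y\<in>?Y1. bl_ident B2 (ret_class ?Y2 (bl_map B2) (h y)) =
        bl_ident B1 (ret_class ?Y1 (bl_map B1) y)) \<longleftrightarrow> (\<forall>y\<in>?Y1. ?p2 (h y) = ?p1 y)"
    if h: "h \<in> ?Y1 \<rightarrow> ?Y2" for h
    using h by (auto simp: blowup_proj_def)
  show ?thesis
    unfolding blowup_mor_def bundle_mor_def bundle_of_blowup_def equivariant_bundle.simps
  proof (rule Collect_cong, rule conj_cong[OF HOL.refl])
    fix h assume "h \<in> ?Y1 \<rightarrow>\<^sub>E ?Y2"
    then have h: "h \<in> ?Y1 \<rightarrow> ?Y2" by (simp add: PiE_def)
    show "homomorphism ?Y1 (bl_map B1) ?Y2 (bl_map B2) h \<and>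
        (\<forall>y\<in>?Y1. bl_ident B2 (ret_class ?Y2 (bl_map B2) (h y)) =
          bl_ident B1 (ret_class ?Y1 (bl_map B1) y)) \<longleftrightarrow>
        (\<forall>y\<in>?Y1. ?p2 (h y) = ?p1 y) \<and>
        (\<forall>a\<in>carrier G\<^sub>X. \<forall>y\<in>?Y1. h (R1.fibre_action a y) = R2.fibre_action a (h y))"
      unfolding over[OF h] using equivariant[OF h] by blast
  qed
qed

end

lemma is_category_Bun:
  fixes X :: "'x set" and G :: "'g monoid" and \<alpha> :: "'g \<Rightarrow> 'x \<Rightarrow> 'x"
  shows "is_category (Bun X G \<alpha> :: (('y, 'x, 'g) equivariant_bundle, 'y \<Rightarrow> 'y) cat)"
proof -
  have closed: "bact E g y \<in> tot_space E"
    if "is_bundle X G \<alpha> E" "g \<in> carrier G" "y \<in> tot_space E" for E :: "('y, 'x, 'g) equivariant_bundle" and g y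
    using that group_action.element_image[of G "tot_space E" "bact E" g y] by (simp add: is_bundle_def)
  have id: "(\<lambda>y\<in>tot_space E. y) \<in> bundle_mor G E E"
    if "is_bundle X G \<alpha> E" for E :: "('y, 'x, 'g) equivariant_bundle"
    using closed[OF that] by (simp add: bundle_mor_def)
  have comp: "compose (tot_space E1) k h \<in> bundle_mor G E1 E3"
    if "is_bundle X G \<alpha> E1" "h \<in> bundle_mor G E1 E2" "k \<in> bundle_mor G E2 E3"
    for E1 E2 E3 :: "('y, 'x, 'g) equivariant_bundle" and h k
  proof -
    have "h y \<in> tot_space E2" if "y \<in> tot_space E1" for y
      using \<open>h \<in> bundle_mor G E1 E2\<close> that by (auto simp: bundle_mor_def)
    then show ?thesis
      using closed[OF that(1)] that(2,3) by (auto simp: bundle_mor_def compose_def)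
  qed
  have ext: "h \<in> extensional (tot_space E1)" "h \<in> tot_space E1 \<rightarrow> tot_space E2"
    if "h \<in> bundle_mor G E1 E2" for E1 E2 :: "('y, 'x, 'g) equivariant_bundle" and h
    using that by (auto simp: bundle_mor_def PiE_def)
  have unit: "compose (tot_space E1) h (\<lambda>y\<in>tot_space E1. y) = h"
    "compose (tot_space E1) (\<lambda>y\<in>tot_space E2. y) h = h"
    if "h \<in> bundle_mor G E1 E2" for E1 E2 :: "('y, 'x, 'g) equivariant_bundle" and h
    by (rule compose_Id[OF ext(2)[OF that] ext(1)[OF that]], rule Id_compose[OF ext(2)[OF that] ext(1)[OF that]])
  have assoc: "compose (tot_space E1) l (compose (tot_space E1) k h)
      = compose (tot_space E1) (compose (tot_space E2) l k) h"
    if "h \<in> bundle_mor G E1 E2" for E1 E2 :: "('y, 'x, 'g) equivariant_bundle" and h k l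
    by (rule compose_assoc[OF ext(2)[OF that]])
  show ?thesis
    unfolding is_category_def Bun_def cat.simps mem_Collect_eq
  proof (intro conjI ballI allI)
  qed (blast intro: id comp unit assoc)+
qed

lemma is_category_full_subcategory: "is_category C \<Longrightarrow> is_category (full_subcategory C P)"
  by (simp add: is_category_def full_subcategory_def)

text \<open>Blow-ups inherit the category axioms from bundles, because their morphism sets agree.\<close>
lemma is_category_pullback:
  assumes "is_category D"
    and "\<And>A. A \<in> Obj C \<Longrightarrow> F A \<in> Obj D"
    and "\<And>A B. A \<in> Obj C \<Longrightarrow> B \<in> Obj C \<Longrightarrow> Mor C A B = Mor D (F A) (F B)"
    and "\<And>A. A \<in> Obj C \<Longrightarrow> Idt C A = Idt D (F A)"
    and "\<And>A B E. A \<in> Obj C \<Longrightarrow> B \<in> Obj C \<Longrightarrow> E \<in> Obj C \<Longrightarrow> Cmp C A B E = Cmp D (F A) (F B) (F E)"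
  shows "is_category C"
  using assms(1) unfolding is_category_def by (simp add: assms(2-5))

context symmetric_set
begin

lemma Obj_Bun_f: "Obj (Bun_f X S) = {E. faithful_bundle_obj E}"
  and Bun_f_simps:
    "Mor (Bun_f X S) = bundle_mor G\<^sub>X"
    "Idt (Bun_f X S) = (\<lambda>E. \<lambda>y\<in>tot_space E. y)"
    "Cmp (Bun_f X S) = (\<lambda>A B D g f. compose (tot_space A) g f)"
  by (auto simp: Bun_f_def Bun_def full_subcategory_def)

lemma is_category_Bun_f: "is_category (Bun_f X S)"
  unfolding Bun_f_def by (intro is_category_full_subcategory is_category_Bun)

lemma bundle_of_blowup_sel [simp]: "tot_space (bundle_of_blowup X S B) = bl_set B"
  by (simp add: bundle_of_blowup_def)

lemma blowup_of_bundle_sel [simp]: "bl_set (blowup_of_bundle X S E) = tot_space E"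
  by (simp add: blowup_of_bundle_def)

lemma BL_simps:
  "Obj (BL X S) = {B. is_blowup X S B}"
  "Mor (BL X S) = blowup_mor"
  "Idt (BL X S) = (\<lambda>B. \<lambda>y\<in>bl_set B. y)"
  "Cmp (BL X S) = (\<lambda>A B D g f. compose (bl_set A) g f)"
  by (simp_all add: BL_def)

lemma is_category_BL: "is_category (BL X S)"
  by (rule is_category_pullback[OF is_category_Bun_f, of _ "bundle_of_blowup X S"])
    (simp_all add: Obj_Bun_f Bun_f_simps BL_simps bundle_of_blowup_obj blowup_mor_eq_bundle_mor)

lemma bundle_mor_eq_blowup_mor:
  assumes "faithful_bundle_obj E1" "faithful_bundle_obj E2"
  shows "bundle_mor G\<^sub>X E1 E2 = blowup_mor (blowup_of_bundle X S E1) (blowup_of_bundle X S E2)"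
  using assms by (simp add: blowup_mor_eq_bundle_mor blowup_of_bundle_obj bundle_of_blowup_of_bundle)

lemma category_isomorphism_BL_Bun_f:
  "category_isomorphism (BL X S) (Bun_f X S)
     \<lparr>on_obj = bundle_of_blowup X S, on_mor = \<lambda>A B h. h\<rparr>
     \<lparr>on_obj = blowup_of_bundle X S, on_mor = \<lambda>A B h. h\<rparr>"
proof
  show "is_functor (BL X S) (Bun_f X S) \<lparr>on_obj = bundle_of_blowup X S, on_mor = \<lambda>A B h. h\<rparr>"
    by (simp add: is_functor_def is_category_BL is_category_Bun_f Obj_Bun_f Bun_f_simps BL_simps
        bundle_of_blowup_obj blowup_mor_eq_bundle_mor)
  show "is_functor (Bun_f X S) (BL X S) \<lparr>on_obj = blowup_of_bundle X S, on_mor = \<lambda>A B h. h\<rparr>"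
    by (simp add: is_functor_def is_category_BL is_category_Bun_f Obj_Bun_f Bun_f_simps BL_simps
        blowup_of_bundle_obj bundle_mor_eq_blowup_mor)
qed (simp_all add: Obj_Bun_f BL_simps blowup_of_bundle_of_blowup bundle_of_blowup_of_bundle)

end

theorem theorem3p7:
  fixes X :: "'x set" and S :: "'x \<times> 'x \<Rightarrow> 'x \<times> 'x"
  assumes "nondeg_symmetric_set X S"
  defines "\<C> \<equiv> (BL X S :: (('y, 'x) blowup, 'y \<Rightarrow> 'y) cat)"
      and "\<D> \<equiv> (Bun_f X S :: (('y, 'x, ('x \<times> bool) list set) equivariant_bundle, 'y \<Rightarrow> 'y) cat)"
  shows "\<exists>F. is_equivalence \<C> \<D> F \<and>
    (\<forall>n::nat. bij_betw (on_iso_class \<D> F)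
       (iso_classes \<C> (\<lambda>B. finite (bl_set B) \<and> card (bl_set B) = n))
       (iso_classes \<D> (\<lambda>E. finite (tot_space E) \<and> card (tot_space E) = n))) \<and>
    (\<forall>N::'y set. bij_betw (on_iso_class \<D> F)
       (iso_classes \<C> (\<lambda>B. bl_set B \<approx> N))
       (iso_classes \<D> (\<lambda>E. tot_space E \<approx> N)))"
proof -
  interpret symmetric_set X S by unfold_locales (rule assms(1))
  define F :: "(('y, 'x) blowup, 'y \<Rightarrow> 'y, ('y, 'x, ('x \<times> bool) list set) equivariant_bundle, 'y \<Rightarrow> 'y) cat_functor"
    where "F = \<lparr>on_obj = bundle_of_blowup X S, on_mor = \<lambda>A B h. h\<rparr>"
  interpret I: category_isomorphism \<C> \<D> F "\<lparr>on_obj = blowup_of_bundle X S, on_mor = \<lambda>A B h. h\<rparr>"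
    unfolding assms(2,3) F_def by (rule category_isomorphism_BL_Bun_f)
  have tot: "tot_space (on_obj F B) = bl_set B" for B by (simp add: F_def)
  show ?thesis
    by (intro exI[of _ F] conjI allI I.equivalence I.bij_betw_iso_classes) (simp_all only: tot)
qed

end
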